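(* There exists a function $w:(0,\frac1{36})\to(0,1)$ with $\lim_{b\downarrow0}w(b)=1$ such that the following holds. Let $0<\beta_0<\frac1{36}$ be a constant. For all integers $1\le k\le p$ and $n\ge1$ and all $\lambda>0$ with $$\lambda\le1\wedge\sqrt{\frac{\beta_0k}{n}\log\frac{\mathrm{e}p}{k}},$$ the minimax sum of Type-I and Type-II error probabilities for testing $H_0:\Sigma=I_p$ against $H_1:\Sigma=I_p+\lambda vv'$, $v\in\mathbb{S}^{p-1}\cap B_0(k)$, satisfies $$\inf_{\phi:\mathbb{R}^{n\times p}\to\{0,1\}}\left(\mathsf{P}_{I_p}\{\phi(X)=1\}+\sup_{\Sigma\in H_1}\mathsf{P}_{\Sigma}\{\phi(X)=0\}\right)\ \ge\ w(\beta_0).$$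
   Context: $a\wedge b=\min(a,b)$, $'$ denotes transpose; $\mathbb{S}^{p-1}$ is the unit sphere of $\mathbb{R}^p$ and $B_0(k)=\{x\in\mathbb{R}^p:x\text{ has at most }k\text{ nonzero entries}\}$. $X$ is an $n\times p$ random matrix whose rows are independently drawn from $N(0,\Sigma)$, and $\mathsf{P}_\Sigma$ is the corresponding probability. $\Sigma\in H_1$ means $\Sigma=I_p+\lambda vv'$ for some $v\in\mathbb{S}^{p-1}\cap B_0(k)$. The infimum is over measurable tests $\phi$. *)

theory Defs
  imports
    "HOL-Probability.Probability"
    "Jordan_Normal_Form.Determinant"
    "Jordan_Normal_Form.Gauss_Jordan_Elimination"
begin

text \<open>
  The dimensions \<open>n\<close>, \<open>p\<close> are natural-number variables. Measures live on product spaces indexed by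
  \<open>{..<p}\<close> and \<open>{..<n}\<close>: a row is an extensional function on \<open>{..<p}\<close>, and \<open>x i j\<close> is the
  \<open>(i, j)\<close> entry of a data matrix \<open>x\<close>. Covariance matrices and spike directions are matrices
  and vectors of \<^theory>\<open>Jordan_Normal_Form.Matrix\<close>.
\<close>

text \<open>The matrix \<open>v v'\<close>.\<close>

definition outer_product :: "real Matrix.vec \<Rightarrow> real Matrix.mat" where
  "outer_product v =
     Matrix.mat (dim_vec v) (dim_vec v) (\<lambda>(i, j). vec_index v i * vec_index v j)"

definition unit_sphere :: "nat \<Rightarrow> real Matrix.vec set" where
  "unit_sphere p = {v \<in> carrier_vec p. sqrt (scalar_prod v v) = 1}"

definition sparse_vecs :: "nat \<Rightarrow> nat \<Rightarrow> real Matrix.vec set" where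
  "sparse_vecs p k = {v \<in> carrier_vec p. card {i. i < p \<and> vec_index v i \<noteq> 0} \<le> k}"

definition spiked_covariances :: "nat \<Rightarrow> nat \<Rightarrow> real \<Rightarrow> real Matrix.mat set" where
  "spiked_covariances p k lam =
     {1\<^sub>m p + lam \<cdot>\<^sub>m outer_product v | v. v \<in> unit_sphere p \<inter> sparse_vecs p k}"

text \<open>
  The density of \<open>N(0, \<Sigma>)\<close>, for a positive definite \<open>p \<times> p\<close> matrix \<open>\<Sigma>\<close>; only such \<open>\<Sigma>\<close> are
  intended as arguments (\<^const>\<open>mat_inverse\<close> is \<^const>\<open>None\<close> for singular matrices).
\<close>

definition mvn_density :: "nat \<Rightarrow> real Matrix.mat \<Rightarrow> (nat \<Rightarrow> real) \<Rightarrow> real" where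
  "mvn_density p S x =
     exp (- scalar_prod (Matrix.vec p x) (the (mat_inverse S) *\<^sub>v Matrix.vec p x) / 2)
       / sqrt ((2 * pi) ^ p * Determinant.det S)"

definition mvn :: "nat \<Rightarrow> real Matrix.mat \<Rightarrow> (nat \<Rightarrow> real) measure" where
  "mvn p S = density (PiM {..<p} (\<lambda>_. lborel)) (\<lambda>x. ennreal (mvn_density p S x))"

text \<open>The law of an \<open>n \<times> p\<close> matrix with independent \<open>N(0, \<Sigma>)\<close> rows.\<close>

definition sample_law :: "nat \<Rightarrow> nat \<Rightarrow> real Matrix.mat \<Rightarrow> (nat \<Rightarrow> nat \<Rightarrow> real) measure" where
  "sample_law n p S = PiM {..<n} (\<lambda>_. mvn p S)"

definition data_space :: "nat \<Rightarrow> nat \<Rightarrow> (nat \<Rightarrow> nat \<Rightarrow> real) measure" where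
  "data_space n p = PiM {..<n} (\<lambda>_. PiM {..<p} (\<lambda>_. borel))"

definition tests :: "nat \<Rightarrow> nat \<Rightarrow> ((nat \<Rightarrow> nat \<Rightarrow> real) \<Rightarrow> nat) set" where
  "tests n p = measurable (data_space n p) (count_space {0, 1})"

definition prob_test_eq ::
  "nat \<Rightarrow> nat \<Rightarrow> real Matrix.mat \<Rightarrow> ((nat \<Rightarrow> nat \<Rightarrow> real) \<Rightarrow> nat) \<Rightarrow> nat \<Rightarrow> real" where
  "prob_test_eq n p S \<phi> a =
     measure (sample_law n p S) {x \<in> space (sample_law n p S). \<phi> x = a}"

text \<open>
  The supremum and infimum are those of the reals; for \<open>1 \<le> k \<le> p\<close> and \<open>lam > 0\<close> they are taken
  over nonempty bounded sets.
\<close>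

definition minimax_testing_error :: "nat \<Rightarrow> nat \<Rightarrow> nat \<Rightarrow> real \<Rightarrow> real" where
  "minimax_testing_error n p k lam =
     (INF \<phi> \<in> tests n p.
        prob_test_eq n p (1\<^sub>m p) \<phi> 1 +
        (SUP S \<in> spiked_covariances p k lam. prob_test_eq n p S \<phi> 0))"

end

theory Submission
  imports Defs
begin

text \<open>
  Put on \<open>v\<close> a uniform prior with one entry \<open>\<plusminus> 1 / sqrt k\<close> in each of \<open>k\<close> disjoint blocks of
  \<open>m = p div k\<close> coordinates, so that \<open>k\<close> times the inner product of two independent draws is a sum \<open>W\<close> of
  \<open>k\<close> independent variables equal to \<open>0\<close> with probability \<open>1 - 1/m\<close> and to \<open>\<plusminus> 1\<close> otherwise. The usual
  second moment of the mixture likelihood ratio, \<open>E (1 - \<lambda>\<^sup>2 W\<^sup>2 / k\<^sup>2) powr (- n / 2)\<close>, may be infinite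
  at \<open>\<lambda> = 1\<close>. Therefore write the rows as \<open>z\<^sub>i + sqrt \<lambda> g\<^sub>i v\<close> and keep only the part of the likelihood
  ratio with \<open>\<Sum> g\<^sub>i\<^sup>2 \<le> M = n / (3 sqrt \<beta>\<^sub>0)\<close>. By Markov's inequality this retains mass at least
  \<open>1 - 3 sqrt \<beta>\<^sub>0\<close>, and the second moment becomes at most
  \<open>E exp (\<lambda>\<^sup>2 M W\<^sup>2 / (2 k\<^sup>2)) \<le> E exp (a L W\<^sup>2 / k)\<close> with \<open>L = ln (e p / k)\<close> and \<open>a = sqrt \<beta>\<^sub>0 / 6\<close>.
  Since \<open>E exp (\<theta> W) \<le> exp (9 k \<theta>\<^sup>2 / L)\<close> for every \<open>\<theta>\<close>, that is at most
  \<open>1 / sqrt (1 - 36 a) = 1 / sqrt (1 - 6 sqrt \<beta>\<^sub>0)\<close>.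
\<close>

section \<open>Spiked covariance matrices\<close>

text \<open>The direction is a function on indices, the form in which rows enter the product
  measures; \<open>Matrix.vec p\<close> converts it.\<close>

definition spiked_cov :: "nat \<Rightarrow> real \<Rightarrow> (nat \<Rightarrow> real) \<Rightarrow> real Matrix.mat" where
  "spiked_cov p c v = 1\<^sub>m p + c \<cdot>\<^sub>m outer_product (Matrix.vec p v)"

lemma spiked_cov_carrier [simp]: "spiked_cov p c v \<in> carrier_mat p p"
  by (auto simp: spiked_cov_def outer_product_def)

lemma spiked_cov_dim [simp]: "dim_row (spiked_cov p c v) = p" "dim_col (spiked_cov p c v) = p"
  using spiked_cov_carrier by blast+

lemma spiked_cov_index:
  "i < p \<Longrightarrow> j < p \<Longrightarrow> spiked_cov p c v $$ (i, j) = of_bool (i = j) + c * v i * v j"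
  by (auto simp: spiked_cov_def outer_product_def)

lemma spiked_cov_0: "spiked_cov p 0 v = 1\<^sub>m p"
  by (rule eq_matI) (auto simp: spiked_cov_index)

text \<open>For a unit vector \<open>v v'\<close> is idempotent, so the family is closed under
  products, and \<open>1 + c\<close>, the eigenvalue along \<open>v\<close>, is
  multiplicative.\<close>

lemma spiked_cov_mult:
  assumes "(\<Sum>j<p. v j * v j) = 1"
  shows "spiked_cov p a v * spiked_cov p b v = spiked_cov p (a + b + a * b) v"
proof (rule eq_matI)
  fix i j assume "i < dim_row (spiked_cov p (a + b + a * b) v)" "j < dim_col (spiked_cov p (a + b + a * b) v)"
  then have ij: "i < p" "j < p" by simp_all
  have "(spiked_cov p a v * spiked_cov p b v) $$ (i, j)
      = (\<Sum>k<p. (of_bool (i = k) + a * v i * v k) * (of_bool (k = j) + b * v k * v j))"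
    using ij by (simp add: scalar_prod_def spiked_cov_index atLeast0LessThan)
  also have "\<dots> = (\<Sum>k<p. (if k = i then of_bool (i = j) else 0) + (if k = i then b * v i * v j else 0)
                  + (if k = j then a * v i * v j else 0) + a * b * v i * v j * (v k * v k))"
    by (intro sum.cong) (auto simp: algebra_simps)
  also have "\<dots> = of_bool (i = j) + b * v i * v j + a * v i * v j + a * b * v i * v j"
    using ij assms by (simp add: sum.distrib sum_distrib_left[symmetric])
  finally show "(spiked_cov p a v * spiked_cov p b v) $$ (i, j) = spiked_cov p (a + b + a * b) v $$ (i, j)"
    using ij by (simp add: spiked_cov_index algebra_simps)
qed simp_all

text \<open>Read off two block factorizations of the matrix with blocks \<open>1\<close>, \<open>- v'\<close>, \<open>c v\<close>, \<open>I\<close>.\<close>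

lemma det_spiked_cov: "Determinant.det (spiked_cov p c v) = 1 + c * (\<Sum>j<p. v j * v j)"
proof -
  define C where "C = Matrix.mat p 1 (\<lambda>(i, j). c * v i)"
  define R where "R = Matrix.mat 1 p (\<lambda>(i, j). - v j)"
  have C: "C \<in> carrier_mat p 1" and R: "R \<in> carrier_mat 1 p" by (auto simp: C_def R_def)
  define s where "s = Matrix.mat 1 1 (\<lambda>_. 1 + c * (\<Sum>j<p. v j * v j))"
  have s: "s \<in> carrier_mat 1 1" by (simp add: s_def)
  let ?S = "spiked_cov p c v"
  let ?L = "four_block_mat (1\<^sub>m 1) (0\<^sub>m 1 p) C (1\<^sub>m p)"
  let ?U = "four_block_mat (1\<^sub>m 1) R (0\<^sub>m p 1) ?S"
  let ?V = "four_block_mat s R (0\<^sub>m p 1) (1\<^sub>m p)"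
  have CR: "C * R + ?S = 1\<^sub>m p"
    by (rule eq_matI) (auto simp: C_def R_def spiked_cov_index scalar_prod_def)
  have RC: "s + R * C = 1\<^sub>m 1"
    by (rule eq_matI)
      (auto simp: C_def R_def s_def scalar_prod_def atLeast0LessThan sum_distrib_left algebra_simps
            simp flip: sum.distrib)
  have "?L * ?U = four_block_mat (1\<^sub>m 1) R C (1\<^sub>m p)"
    by (subst mult_four_block_mat[OF one_carrier_mat zero_carrier_mat C one_carrier_mat
          one_carrier_mat R zero_carrier_mat spiked_cov_carrier]) (use C R CR in simp)
  moreover have "?V * ?L = four_block_mat (1\<^sub>m 1) R C (1\<^sub>m p)"
    by (subst mult_four_block_mat[OF s R zero_carrier_mat one_carrier_mat
          one_carrier_mat zero_carrier_mat C one_carrier_mat]) (use C R RC s in simp)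
  ultimately have "?L * ?U = ?V * ?L" by simp
  then have "Determinant.det ?L * Determinant.det ?U = Determinant.det ?V * Determinant.det ?L"
    using C R s by (metis det_mult four_block_carrier_mat one_carrier_mat spiked_cov_carrier)
  moreover have "Determinant.det ?L = 1"
    using C by (subst det_four_block_mat_upper_right_zero[where n = 1 and m = p]) auto
  moreover have "Determinant.det ?U = Determinant.det ?S"
    using R by (subst det_four_block_mat_lower_left_zero[where n = 1 and m = p]) auto
  moreover have "Determinant.det ?V = 1 + c * (\<Sum>j<p. v j * v j)"
    using R s
    by (subst det_four_block_mat_lower_left_zero[where n = 1 and m = p]) (auto simp: det_single s_def)
  ultimately show ?thesis by simp
qed

text \<open>Sherman-Morrison: by \<open>spiked_cov_mult\<close> the inverse has the parameter
  \<open>b\<close> that solves \<open>c + b + c * b = 0\<close>.\<close>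

lemma mat_inverse_spiked_cov:
  assumes v: "(\<Sum>j<p. v j * v j) = 1" and c: "c > -1"
  shows "mat_inverse (spiked_cov p c v) = Some (spiked_cov p (- c / (1 + c)) v)"
proof -
  let ?S = "spiked_cov p c v" and ?T = "spiked_cov p (- c / (1 + c)) v"
  have *: "c + - c / (1 + c) + c * (- c / (1 + c)) = 0" "- c / (1 + c) + c + - c / (1 + c) * c = 0"
    using c by (simp_all add: field_simps)
  have TS: "?T * ?S = 1\<^sub>m p" and ST: "?S * ?T = 1\<^sub>m p"
    by (simp_all only: spiked_cov_mult[OF v] * spiked_cov_0)
  \<comment> \<open>\<open>mat_inverse\<close> is specified through the units of the matrix ring:
    invertibility excludes \<open>None\<close>, and uniqueness of inverses then identifies the
    value.\<close>
  have "?S \<in> Units (ring_mat TYPE(real) p ())"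
    unfolding Units_def ring_mat_def using TS ST
    by (auto intro!: bexI[of _ ?T])
  then obtain B where B: "mat_inverse ?S = Some B"
    using mat_inverse(1)[OF spiked_cov_carrier, of p c v "()"] by (cases "mat_inverse ?S") auto
  have "B \<in> carrier_mat p p" "?S * B = 1\<^sub>m p"
    using mat_inverse(2)[OF spiked_cov_carrier B] by auto
  then have "?T * (?S * B) = ?T" by (simp only: right_mult_one_mat[OF spiked_cov_carrier])
  then have "?T * ?S * B = ?T"
    using \<open>B \<in> carrier_mat p p\<close> by (simp only: assoc_mult_mat[OF spiked_cov_carrier spiked_cov_carrier])
  then have "B = ?T" using \<open>B \<in> carrier_mat p p\<close> unfolding TS by simp
  then show ?thesis using B by simp
qed

lemma spiked_cov_quadratic_form:
  "scalar_prod (Matrix.vec p x) (spiked_cov p c v *\<^sub>v Matrix.vec p x)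
     = (\<Sum>j<p. x j * x j) + c * (\<Sum>j<p. v j * x j)\<^sup>2"
proof -
  have "scalar_prod (Matrix.vec p x) (spiked_cov p c v *\<^sub>v Matrix.vec p x)
      = (\<Sum>i<p. x i * (\<Sum>j<p. (of_bool (i = j) + c * v i * v j) * x j))"
    by (simp add: scalar_prod_def spiked_cov_index atLeast0LessThan)
  also have "\<dots> = (\<Sum>i<p. x i * (x i + c * v i * (\<Sum>j<p. v j * x j)))"
  proof (intro sum.cong refl, goal_cases)
    case (1 i)
    have "(\<Sum>j<p. (of_bool (i = j) + c * v i * v j) * x j)
        = (\<Sum>j<p. (if j = i then x i else 0) + c * v i * (v j * x j))"
      by (intro sum.cong) (auto simp: algebra_simps)
    then show ?case using 1 by (simp add: sum.distrib sum_distrib_left)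
  qed
  also have "\<dots> = (\<Sum>i<p. x i * x i + c * (\<Sum>j<p. v j * x j) * (v i * x i))"
    by (intro sum.cong) (auto simp: algebra_simps)
  finally show ?thesis by (simp add: sum.distrib sum_distrib_left[symmetric] power2_eq_square)
qed

text \<open>The ratio to the standard density depends on \<open>x\<close> only through its component
  along \<open>v\<close>: the inverse contributes \<open>c / (1 + c)\<close>, the determinant
  \<open>1 + c\<close>.\<close>

lemma mvn_density_spiked_cov:
  assumes v: "(\<Sum>j<p. v j * v j) = 1" and c: "c > -1"
  shows "mvn_density p (spiked_cov p c v) x =
    mvn_density p (1\<^sub>m p) x * (exp ((c / (1 + c)) * (\<Sum>j<p. v j * x j)\<^sup>2 / 2) / sqrt (1 + c))"
proof -
  have *: "mvn_density p (spiked_cov p c v) x =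
      exp (- ((\<Sum>j<p. x j * x j) + - c / (1 + c) * (\<Sum>j<p. v j * x j)\<^sup>2) / 2)
        / sqrt ((2 * pi) ^ p * (1 + c))" if "c > -1" for c
    using that v by (simp add: mvn_density_def mat_inverse_spiked_cov spiked_cov_quadratic_form det_spiked_cov)
  define Q where "Q = (\<Sum>j<p. x j * x j)"
  define d where "d = c / (1 + c) * (\<Sum>j<p. v j * x j)\<^sup>2"
  have "exp (- (Q + - c / (1 + c) * (\<Sum>j<p. v j * x j)\<^sup>2) / 2) = exp (- Q / 2 + d / 2)"
    by (simp add: d_def diff_divide_distrib)
  then have "mvn_density p (spiked_cov p c v) x = exp (- Q / 2) / sqrt ((2 * pi) ^ p) * (exp (d / 2) / sqrt (1 + c))"
    unfolding *[OF c] Q_def[symmetric] exp_add real_sqrt_mult by simp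
  moreover have "mvn_density p (1\<^sub>m p) x = exp (- Q / 2) / sqrt ((2 * pi) ^ p)"
    using *[of 0] by (simp add: spiked_cov_0 Q_def)
  ultimately show ?thesis by (simp only: d_def)
qed

lemma mvn_density_identity: "mvn_density p (1\<^sub>m p) x = (\<Prod>j<p. std_normal_density (x j))"
proof -
  \<comment> \<open>Computed directly: \<open>mat_inverse_spiked_cov\<close> asks for a unit vector,
    and there is none for \<open>p = 0\<close>.\<close>
  have inv: "mat_inverse (1\<^sub>m p :: real Matrix.mat) = Some (1\<^sub>m p)"
  proof -
    have "(1\<^sub>m p :: real Matrix.mat) \<in> Units (ring_mat TYPE(real) p ())"
      unfolding Units_def ring_mat_def by (auto intro!: bexI[of _ "1\<^sub>m p"])
    then obtain B where B: "mat_inverse (1\<^sub>m p :: real Matrix.mat) = Some B"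
      using mat_inverse(1)[OF one_carrier_mat, of p "()"] by (cases "mat_inverse (1\<^sub>m p :: real Matrix.mat)") auto
    with mat_inverse(2)[OF one_carrier_mat B] show ?thesis by auto
  qed
  have "(\<Prod>j<p. std_normal_density (x j)) = exp (- (\<Sum>j<p. x j * x j) / 2) / sqrt (2 * pi) ^ p"
  proof (induction p)
    case (Suc p)
    have "exp (- (\<Sum>j<Suc p. x j * x j) / 2) = exp (- (\<Sum>j<p. x j * x j) / 2) * exp (- (x p)\<^sup>2 / 2)"
      by (simp add: power2_eq_square diff_divide_distrib mult_exp_exp)
    then show ?case
      unfolding prod.lessThan_Suc Suc.IH by (simp only: std_normal_density_def) simp
  qed simp
  moreover have "sqrt (2 * pi) ^ p = sqrt ((2 * pi) ^ p)" by (rule real_sqrt_power[symmetric])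
  moreover have "scalar_prod (Matrix.vec p x) (1\<^sub>m p *\<^sub>v Matrix.vec p x) = (\<Sum>j<p. x j * x j)"
    using spiked_cov_quadratic_form[of p x 0] by (simp add: spiked_cov_0)
  ultimately show ?thesis by (simp only: mvn_density_def inv option.sel det_one mult_1_right)
qed

section \<open>Scalar inequalities and Gaussian integrals\<close>

text \<open>\<open>2 * (cosh x - 1)\<close> equals \<open>exp x * (1 - exp (- x))\<^sup>2\<close>,
  and \<open>1 - exp (- x) \<le> x\<close>.\<close>

lemma cosh_bound:
  fixes x :: real assumes "0 \<le> x" shows "cosh x - 1 \<le> x\<^sup>2 * exp x / 2"
proof -
  have "1 - exp (- x) \<le> x" using exp_ge_add_one_self[of "- x"] by linarith
  then have "(1 - exp (- x))\<^sup>2 \<le> x\<^sup>2" using assms by (intro power_mono) auto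
  then have "exp x * (1 - exp (- x))\<^sup>2 \<le> exp x * x\<^sup>2" by simp
  moreover have "exp x * (1 - exp (- x))\<^sup>2 = 2 * (cosh x - 1)"
  proof -
    have e: "exp x * exp (- x) = 1" by (simp flip: exp_add)
    have "exp x * (1 - exp (- x))\<^sup>2 = exp x - 2 * (exp x * exp (- x)) + (exp x * exp (- x)) * exp (- x)"
      by (simp add: power2_eq_square algebra_simps)
    then show ?thesis unfolding e by (simp add: cosh_def)
  qed
  ultimately show ?thesis by (simp add: field_simps)
qed

text \<open>For small \<open>\<theta>\<close> the variance factor \<open>1 / m\<close> outweighs the logarithm \<open>L\<close>; for large \<open>\<theta>\<close> the
  trivial bound \<open>exp \<bar>\<theta>\<bar>\<close> suffices.\<close>

lemma sparse_sign_mgf_le: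
  fixes L \<theta> m :: real
  assumes m: "1 \<le> m" and L: "1 \<le> L" "exp L \<le> 2 * exp 1 * m"
  shows "1 + (cosh \<theta> - 1) / m \<le> exp (9 * \<theta>\<^sup>2 / L)"
proof -
  have *: "1 + (cosh \<theta> - 1) / m \<le> exp (9 * \<theta>\<^sup>2 / L)" if \<theta>: "0 \<le> \<theta>" for \<theta> :: real
  proof (cases "\<theta> \<le> L / 9")
    case True
    \<comment> \<open>The tangent bound absorbs the factor \<open>L\<close> into
      \<open>exp (L / 2)\<close>, and \<open>\<theta> \<le> L / 9\<close> keeps the total exponent
      at most \<open>L - 1\<close>.\<close>
    have "L / 2 \<le> exp (L / 2 - 1)" using exp_ge_add_one_self[of "L / 2 - 1"] by linarith
    then have "exp \<theta> * L \<le> exp (L / 9) * (2 * exp (L / 2 - 1))"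
      using True L by (intro mult_mono) auto
    also have "\<dots> = 2 * exp (L / 9 + (L / 2 - 1))" by (simp only: exp_add mult.left_commute)
    also have "\<dots> \<le> 2 * exp (L - 1)" using L by simp
    also have "\<dots> = 2 / exp 1 * exp L" by (simp add: exp_diff)
    also have "\<dots> \<le> 2 / exp 1 * (2 * exp 1 * m)" using L by (intro mult_left_mono) auto
    also have "\<dots> \<le> 18 * m" using m by simp
    finally have "\<theta>\<^sup>2 * (exp \<theta> * L) \<le> \<theta>\<^sup>2 * (18 * m)" by (intro mult_left_mono) auto
    then have "\<theta>\<^sup>2 * exp \<theta> / 2 / m \<le> 9 * \<theta>\<^sup>2 / L" using m L by (simp add: field_simps)
    moreover have "(cosh \<theta> - 1) / m \<le> \<theta>\<^sup>2 * exp \<theta> / 2 / m"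
      using cosh_bound[OF \<theta>] m by (intro divide_right_mono) auto
    ultimately show ?thesis using exp_ge_add_one_self[of "9 * \<theta>\<^sup>2 / L"] by linarith
  next
    case False
    have "(cosh \<theta> - 1) / m \<le> cosh \<theta> - 1"
      using m cosh_real_ge_1[of \<theta>] mult_left_mono[of 1 m "cosh \<theta> - 1"] by (simp add: field_simps)
    moreover have "cosh \<theta> \<le> exp \<theta>" using \<theta> by (simp add: cosh_def)
    \<comment> \<open>Beyond the threshold \<open>9 * \<theta> / L\<close> exceeds 1, so
      \<open>\<theta> \<le> 9 * \<theta>\<^sup>2 / L\<close>.\<close>
    moreover have "exp \<theta> \<le> exp (9 * \<theta>\<^sup>2 / L)"
      using False L \<theta> mult_left_mono[of "L" "9 * \<theta>" \<theta>] by (simp add: field_simps power2_eq_square)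
    ultimately show ?thesis by linarith
  qed
  show ?thesis using *[of "\<bar>\<theta>\<bar>"] by simp
qed

section \<open>Gaussian integrals and product densities\<close>

abbreviation std_normal :: "real measure" where
  "std_normal \<equiv> density lborel std_normal_density"

interpretation std_normal: prob_space std_normal
  by (rule prob_space_normal_density) simp

text \<open>Completing the square leaves a constant times a normal density. Negative
  \<open>c\<close> is included because the bound on the squared overlap takes
  \<open>c = - 36 * a\<close>.\<close>

lemma nn_integral_std_normal_exp_quadratic:
  fixes b c :: real assumes c: "c > -1"
  shows "(\<integral>\<^sup>+x. ennreal (exp (b * x - c * x\<^sup>2 / 2)) \<partial>std_normal)
       = ennreal (exp (b\<^sup>2 / (2 * (1 + c))) / sqrt (1 + c))"
proof -
  define s where "s = 1 / sqrt (1 + c)"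
  define \<mu> where "\<mu> = b / (1 + c)"
  have s: "s > 0" "s\<^sup>2 = 1 / (1 + c)" using c by (simp_all add: s_def power_divide)
  let ?K = "exp (b\<^sup>2 / (2 * (1 + c))) / sqrt (1 + c)"
  have eq: "std_normal_density x * exp (b * x - c * x\<^sup>2 / 2) = ?K * normal_density \<mu> s x" for x
  proof -
    have "- x\<^sup>2 / 2 + (b * x - c * x\<^sup>2 / 2) = b\<^sup>2 / (2 * (1 + c)) + - (x - \<mu>)\<^sup>2 / (2 * s\<^sup>2)"
      unfolding s \<mu>_def using c
      by (simp add: divide_simps) (simp add: power2_eq_square algebra_simps)
    then show ?thesis
      unfolding std_normal_density_def normal_density_def s(2) using c
      by (simp add: real_sqrt_divide real_sqrt_mult divide_simps flip: exp_add)
  qed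
  have "(\<integral>\<^sup>+x. ennreal (exp (b * x - c * x\<^sup>2 / 2)) \<partial>std_normal)
      = (\<integral>\<^sup>+x. ennreal (std_normal_density x * exp (b * x - c * x\<^sup>2 / 2)) \<partial>lborel)"
    by (subst nn_integral_density) (simp_all add: ennreal_mult)
  also have "\<dots> = (\<integral>\<^sup>+x. ennreal ?K * ennreal (normal_density \<mu> s x) \<partial>lborel)"
    unfolding eq using c by (intro nn_integral_cong ennreal_mult) auto
  also have "\<dots> = ennreal ?K * (\<integral>\<^sup>+x. ennreal (normal_density \<mu> s x) \<partial>lborel)"
    by (intro nn_integral_cmult) simp
  also have "(\<integral>\<^sup>+x. ennreal (normal_density \<mu> s x) \<partial>lborel) = 1"
    using prob_space.emeasure_space_1[OF prob_space_normal_density[OF s(1), of \<mu>]]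
    by (simp add: emeasure_density)
  finally show ?thesis by simp
qed

lemma nn_integral_std_normal_exp:
  "(\<integral>\<^sup>+x. ennreal (exp (b * x)) \<partial>std_normal) = ennreal (exp (b\<^sup>2 / 2))"
  using nn_integral_std_normal_exp_quadratic[of 0 b] by simp

lemma nn_integral_std_normal_square: "(\<integral>\<^sup>+x. ennreal (x\<^sup>2) \<partial>std_normal) = 1"
proof -
  have "(\<integral>\<^sup>+x. ennreal (x\<^sup>2) \<partial>std_normal) = (\<integral>\<^sup>+x. ennreal (std_normal_density x * x\<^sup>2) \<partial>lborel)"
    by (subst nn_integral_density) (simp_all add: ennreal_mult)
  also have "\<dots> = 1"
    using std_normal_moment_even[of 1]
    by (subst nn_integral_eq_integral) (auto simp: has_bochner_integral_iff)
  finally show ?thesis .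
qed

text \<open>A sigma-finite product measure is determined by its boxes, and on a box both the density
  and the indicator factor over the coordinates.\<close>

lemma PiM_density:
  assumes "finite I" "sigma_finite_measure M" and f [measurable]: "f \<in> borel_measurable M"
    and "sigma_finite_measure (density M f)"
  shows "PiM I (\<lambda>_. density M f) = density (PiM I (\<lambda>_. M)) (\<lambda>x. \<Prod>i\<in>I. f (x i))"
proof -
  interpret M: product_sigma_finite "\<lambda>_. M" using assms by (simp add: product_sigma_finite_def)
  interpret D: product_sigma_finite "\<lambda>_. density M f" using assms by (simp add: product_sigma_finite_def)
  show ?thesis
  proof (rule D.PiM_eqI[symmetric, OF \<open>finite I\<close>])
    show "sets (density (PiM I (\<lambda>_. M)) (\<lambda>x. \<Prod>i\<in>I. f (x i))) = sets (PiM I (\<lambda>_. density M f))"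
      by (simp cong: sets_PiM_cong)
    fix A assume "\<And>i. i \<in> I \<Longrightarrow> A i \<in> sets (density M f)"
    then have A: "A i \<in> sets M" if "i \<in> I" for i using that by simp
    have PA: "Pi\<^sub>E I A \<in> sets (PiM I (\<lambda>_. M))" using A assms(1) by (intro sets_PiM_I_finite) auto
    have "emeasure (density (PiM I (\<lambda>_. M)) (\<lambda>x. \<Prod>i\<in>I. f (x i))) (Pi\<^sub>E I A)
        = (\<integral>\<^sup>+x. (\<Prod>i\<in>I. f (x i)) * indicator (Pi\<^sub>E I A) x \<partial>PiM I (\<lambda>_. M))"
      using PA assms(1) by (intro emeasure_density) auto
    also have "\<dots> = (\<integral>\<^sup>+x. (\<Prod>i\<in>I. f (x i) * indicator (A i) (x i)) \<partial>PiM I (\<lambda>_. M))"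
    proof (intro nn_integral_cong)
      fix x assume "x \<in> space (PiM I (\<lambda>_. M))"
      then have "indicator (Pi\<^sub>E I A) x = (\<Prod>i\<in>I. indicator (A i) (x i) :: ennreal)"
        using assms(1) by (auto simp: indicator_def space_PiM PiE_iff prod_zero)
      then show "(\<Prod>i\<in>I. f (x i)) * indicator (Pi\<^sub>E I A) x = (\<Prod>i\<in>I. f (x i) * indicator (A i) (x i))"
        by (simp add: prod.distrib)
    qed
    also have "\<dots> = (\<Prod>i\<in>I. \<integral>\<^sup>+x. f x * indicator (A i) x \<partial>M)"
      using A assms(1)
      by (intro M.product_nn_integral_prod borel_measurable_times_ennreal borel_measurable_indicator f) auto
    also have "\<dots> = (\<Prod>i\<in>I. emeasure (density M f) (A i))"
      using A by (intro prod.cong) (simp_all add: emeasure_density)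
    finally show "emeasure (density (PiM I (\<lambda>_. M)) (\<lambda>x. \<Prod>i\<in>I. f (x i))) (Pi\<^sub>E I A)
        = (\<Prod>i\<in>I. emeasure (density M f) (A i))" .
  qed
qed

section \<open>The block prior\<close>

text \<open>The coordinates below \<open>k m\<close> are split into \<open>k\<close> blocks of length \<open>m\<close>; the prior places one signed
  entry of size \<open>1 / sqrt k\<close> in each block.\<close>

definition block_patterns :: "nat \<Rightarrow> nat \<Rightarrow> (nat \<Rightarrow> nat \<times> real) set" where
  "block_patterns k m = {..<k} \<rightarrow>\<^sub>E {..<m} \<times> {-1, 1}"

text \<open>A pattern maps each block to an offset and a sign. Coordinate \<open>i\<close> has block
  \<open>i div m\<close> and offset \<open>i mod m\<close>; the coordinates from
  \<open>k * m\<close> on stay zero.\<close>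

definition block_vec :: "nat \<Rightarrow> nat \<Rightarrow> (nat \<Rightarrow> nat \<times> real) \<Rightarrow> nat \<Rightarrow> real" where
  "block_vec k m f i =
     (if i < k * m \<and> fst (f (i div m)) = i mod m then snd (f (i div m)) / sqrt (real k) else 0)"

text \<open>This is \<open>W\<close>, which is \<open>k\<close> times the inner product of the block
  vectors: each block contributes -1, 0 or 1.\<close>

definition pattern_overlap :: "nat \<Rightarrow> (nat \<Rightarrow> nat \<times> real) \<Rightarrow> (nat \<Rightarrow> nat \<times> real) \<Rightarrow> real" where
  "pattern_overlap k f h = (\<Sum>b<k. of_bool (fst (f b) = fst (h b)) * snd (f b) * snd (h b))"

lemma finite_block_patterns [simp]: "finite (block_patterns k m)"
  by (auto simp: block_patterns_def intro!: finite_PiE)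

lemma card_block_patterns: "card (block_patterns k m) = (2 * m) ^ k"
proof -
  have "card ({..<m} \<times> {-1, 1 :: real}) = 2 * m" by (simp add: card_cartesian_product)
  then show ?thesis by (simp only: block_patterns_def card_PiE prod_constant card_lessThan finite_lessThan)
qed

text \<open>Each vector has one nonzero entry per block, so a block contributes only when the two
  offsets agree.\<close>

lemma block_vec_inner:
  assumes "f \<in> block_patterns k m" "h \<in> block_patterns k m" "0 < m" "k * m \<le> p"
  shows "(\<Sum>i<p. block_vec k m f i * block_vec k m h i) = pattern_overlap k f h / real k"
proof -
  have "(\<Sum>i<p. block_vec k m f i * block_vec k m h i) = (\<Sum>i<k * m. block_vec k m f i * block_vec k m h i)"
    using assms by (intro sum.mono_neutral_right) (auto simp: block_vec_def)
  also have "\<dots> = (\<Sum>b<k. \<Sum>i\<in>{b * m..<b * m + m}. block_vec k m f i * block_vec k m h i)"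
    by (rule sum.nat_group[symmetric])
  also have "\<dots> = (\<Sum>b<k. of_bool (fst (f b) = fst (h b)) * snd (f b) * snd (h b) / real k)"
  proof (intro sum.cong refl)
    fix b assume "b \<in> {..<k}"
    then have b: "b < k" by simp
    have fb: "fst (f b) < m" using assms(1) b by (auto simp: block_patterns_def PiE_iff mem_Times_iff)
    have "(\<Sum>i\<in>{b * m..<b * m + m}. block_vec k m f i * block_vec k m h i)
        = (\<Sum>j\<in>{..<m}. block_vec k m f (b * m + j) * block_vec k m h (b * m + j))"
      by (rule sum.reindex_bij_witness[of _ "\<lambda>j. b * m + j" "\<lambda>i. i - b * m"]) auto
    also have "\<dots> = (\<Sum>j\<in>{..<m}. if j = fst (f b) then of_bool (fst (f b) = fst (h b)) * snd (f b) * snd (h b) / real k else 0)"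
    proof (intro sum.cong refl)
      fix j assume "j \<in> {..<m}"
      then have j: "j < m" by simp
      have "b * m + j < k * m"
      proof -
        have "b * m + j < (b + 1) * m" using j by simp
        also have "\<dots> \<le> k * m" using b by (intro mult_right_mono) auto
        finally show ?thesis .
      qed
      then show "block_vec k m f (b * m + j) * block_vec k m h (b * m + j)
          = (if j = fst (f b) then of_bool (fst (f b) = fst (h b)) * snd (f b) * snd (h b) / real k else 0)"
        using j by (auto simp: block_vec_def)
    qed
    also have "\<dots> = of_bool (fst (f b) = fst (h b)) * snd (f b) * snd (h b) / real k" using fb by simp
    finally show "(\<Sum>i\<in>{b * m..<b * m + m}. block_vec k m f i * block_vec k m h i)
        = of_bool (fst (f b) = fst (h b)) * snd (f b) * snd (h b) / real k" .
  qed
  finally show ?thesis by (simp add: pattern_overlap_def sum_divide_distrib)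
qed

lemma block_vec_norm:
  assumes "f \<in> block_patterns k m" "0 < m" "k * m \<le> p" "0 < k"
  shows "(\<Sum>i<p. block_vec k m f i * block_vec k m f i) = 1"
proof -
  have "snd (f b) * snd (f b) = 1" if "b < k" for b
  proof -
    have "snd (f b) = - 1 \<or> snd (f b) = 1" using assms(1) that by (auto simp: block_patterns_def PiE_iff mem_Times_iff)
    then show ?thesis by (elim disjE) simp_all
  qed
  then have "pattern_overlap k f f = real k" by (simp add: pattern_overlap_def)
  then show ?thesis using assms by (simp add: block_vec_inner)
qed

lemma block_vec_sparse:
  assumes "0 < m"
  shows "card {i. i < p \<and> block_vec k m f i \<noteq> 0} \<le> k"
proof -
  have "card {i. i < p \<and> block_vec k m f i \<noteq> 0} \<le> card {..<k}"
  proof (rule card_inj_on_le)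
    \<comment> \<open>Within a block only the offset chosen by \<open>f\<close> carries an entry, so
      the block index determines the coordinate.\<close>
    show "inj_on (\<lambda>i. i div m) {i. i < p \<and> block_vec k m f i \<noteq> 0}"
      by (intro inj_onI) (metis (mono_tags, lifting) block_vec_def div_mult_mod_eq mem_Collect_eq)
    show "(\<lambda>i. i div m) ` {i. i < p \<and> block_vec k m f i \<noteq> 0} \<subseteq> {..<k}"
      using assms by (auto simp: block_vec_def less_mult_imp_div_less split: if_splits)
  qed simp
  then show ?thesis by simp
qed

lemma block_vec_mem_spiked_covariances:
  assumes "f \<in> block_patterns k m" "0 < m" "k * m \<le> p" "0 < k"
  shows "spiked_cov p lam (block_vec k m f) \<in> spiked_covariances p k lam"
proof -
  have "{i. i < p \<and> Matrix.vec p (block_vec k m f) $ i \<noteq> 0} = {i. i < p \<and> block_vec k m f i \<noteq> 0}"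
    by auto
  then show ?thesis
    using block_vec_norm[OF assms] block_vec_sparse[OF assms(2), of p k f]
    unfolding spiked_covariances_def spiked_cov_def unit_sphere_def sparse_vecs_def
    by (intro CollectI exI[of _ "Matrix.vec p (block_vec k m f)"])
      (simp add: scalar_prod_def atLeast0LessThan)
qed

section \<open>Exponential moments of the overlap\<close>

text \<open>Up to \<open>(2 * m) ^ k\<close>, the number of patterns, this is the moment generating
  function of the overlap with a uniform \<open>h\<close>. The blocks of \<open>h\<close> are
  independent, so the sum factors.\<close>

lemma sum_exp_overlap:
  assumes f: "f \<in> block_patterns k m" and m: "0 < m"
  shows "(\<Sum>h\<in>block_patterns k m. exp (\<theta> * pattern_overlap k f h))
       = real ((2 * m) ^ k) * (1 + (cosh \<theta> - 1) / real m) ^ k"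
proof -
  let ?g = "\<lambda>b y. exp (\<theta> * (of_bool (fst (f b) = fst y) * snd (f b) * snd y))"
  have "(\<Sum>h\<in>block_patterns k m. exp (\<theta> * pattern_overlap k f h))
      = (\<Sum>h\<in>block_patterns k m. \<Prod>b<k. ?g b (h b))"
    by (simp add: pattern_overlap_def sum_distrib_left exp_sum)
  also have "\<dots> = (\<Prod>b<k. \<Sum>y\<in>{..<m} \<times> {-1, 1}. ?g b y)"
    unfolding block_patterns_def by (rule prod_sum_PiE[symmetric]) auto
  also have "\<dots> = (\<Prod>b<k. 2 * m * (1 + (cosh \<theta> - 1) / real m))"
  proof (intro prod.cong refl)
    fix b assume "b \<in> {..<k}"
    then have fb: "fst (f b) < m" "snd (f b) = 1 \<or> snd (f b) = -1"
      using f by (auto simp: block_patterns_def PiE_iff mem_Times_iff)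
    have "(\<Sum>y\<in>{..<m} \<times> {-1, 1}. ?g b y) = (\<Sum>j<m. \<Sum>e\<in>{-1, 1}. ?g b (j, e))"
      unfolding sum.cartesian_product by (simp only: case_prod_eta prod.collapse case_prod_unfold)
    \<comment> \<open>At the matching offset the two signs give \<open>2 * cosh \<theta>\<close>;
      each of the other offsets gives 2.\<close>
    also have "\<dots> = (\<Sum>j<m. 2 + (if j = fst (f b) then 2 * cosh \<theta> - 2 else 0))"
      using fb(2) by (intro sum.cong) (auto simp: cosh_def)
    also have "\<dots> = 2 * real m + 2 * (cosh \<theta> - 1)" using fb(1) by (simp add: sum.distrib)
    finally show "(\<Sum>y\<in>{..<m} \<times> {-1, 1}. ?g b y) = 2 * m * (1 + (cosh \<theta> - 1) / real m)"
      using m by (simp only:) (simp add: field_simps)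
  qed
  finally show ?thesis by (simp add: power_mult_distrib)
qed

text \<open>The square in the exponent is linearized by \<open>exp (s\<^sup>2 / 2) = E exp (s g)\<close> with \<open>g\<close> standard normal.\<close>

lemma sum_exp_overlap_square_le:
  assumes f: "f \<in> block_patterns k m" and m: "0 < m" and k: "0 < k"
    and L: "1 \<le> L" "exp L \<le> 2 * exp 1 * real m" and a: "0 \<le> a" "36 * a < 1"
  shows "(\<Sum>h\<in>block_patterns k m. exp (a * L / real k * (pattern_overlap k f h)\<^sup>2))
       \<le> real ((2 * m) ^ k) / sqrt (1 - 36 * a)"
proof -
  \<comment> \<open>Scaled so that \<open>(r * W)\<^sup>2 / 2\<close> is the exponent
    \<open>a * L / k * W\<^sup>2\<close>.\<close>
  define r where "r = sqrt (2 * (a * L / real k))"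
  have r: "r\<^sup>2 = 2 * (a * L / real k)" using a L by (simp add: r_def)
  let ?P = "block_patterns k m" and ?W = "pattern_overlap k f"
  have "ennreal (\<Sum>h\<in>?P. exp (a * L / real k * (?W h)\<^sup>2)) = (\<Sum>h\<in>?P. ennreal (exp ((r * ?W h)\<^sup>2 / 2)))"
    by (subst sum_ennreal) (simp_all add: power_mult_distrib r mult_ac)
  also have "\<dots> = (\<Sum>h\<in>?P. \<integral>\<^sup>+g. ennreal (exp (r * ?W h * g)) \<partial>std_normal)"
    by (simp add: nn_integral_std_normal_exp)
  also have "\<dots> = (\<integral>\<^sup>+g. ennreal (\<Sum>h\<in>?P. exp (r * g * ?W h)) \<partial>std_normal)"
    by (subst nn_integral_sum[symmetric]) (auto simp: mult_ac intro!: nn_integral_cong)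
  also have "\<dots> \<le> (\<integral>\<^sup>+g. ennreal (real ((2 * m) ^ k)) * ennreal (exp (0 * g - (- 36 * a) * g\<^sup>2 / 2)) \<partial>std_normal)"
  proof (intro nn_integral_mono)
    fix g :: real
    have "(1 + (cosh (r * g) - 1) / real m) ^ k \<le> exp (9 * (r * g)\<^sup>2 / L) ^ k"
      using m L cosh_real_ge_1[of "r * g"] by (intro power_mono sparse_sign_mgf_le) auto
    \<comment> \<open>Both \<open>k\<close> and \<open>L\<close> cancel. The Gaussian integral of
      \<open>exp (18 * a * g\<^sup>2)\<close> is finite exactly when
      \<open>36 * a < 1\<close>.\<close>
    also have "\<dots> = exp (18 * (a * g\<^sup>2))"
      using k L by (simp add: power_mult_distrib r field_simps flip: exp_of_nat_mult)
    finally show "ennreal (\<Sum>h\<in>?P. exp (r * g * ?W h))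
      \<le> ennreal (real ((2 * m) ^ k)) * ennreal (exp (0 * g - (- 36 * a) * g\<^sup>2 / 2))"
      unfolding sum_exp_overlap[OF f m] by (subst ennreal_mult[symmetric]) (auto intro!: ennreal_leI mult_left_mono)
  qed
  also have "\<dots> = ennreal (real ((2 * m) ^ k)) * ennreal (1 / sqrt (1 - 36 * a))"
    using a nn_integral_std_normal_exp_quadratic[of "- 36 * a" 0]
    by (subst nn_integral_cmult) auto
  also have "\<dots> = ennreal (real ((2 * m) ^ k) / sqrt (1 - 36 * a))"
    using a by (subst ennreal_mult[symmetric]) auto
  finally show ?thesis using a by (subst (asm) ennreal_le_iff) auto
qed

section \<open>Truncated likelihood ratios\<close>

abbreviation std_normal_vec :: "nat \<Rightarrow> (nat \<Rightarrow> real) measure" where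
  "std_normal_vec p \<equiv> PiM {..<p} (\<lambda>_. std_normal)"

abbreviation std_normal_mat :: "nat \<Rightarrow> nat \<Rightarrow> (nat \<Rightarrow> nat \<Rightarrow> real) measure" where
  "std_normal_mat n p \<equiv> PiM {..<n} (\<lambda>_. std_normal_vec p)"

lemma prob_space_std_normal_vec: "prob_space (std_normal_vec p)"
  by (intro prob_space_PiM std_normal.prob_space_axioms)

lemma prob_space_std_normal_mat: "prob_space (std_normal_mat n p)"
  by (intro prob_space_PiM prob_space_std_normal_vec)

interpretation std_normal_vec: prob_space "std_normal_vec p" for p
  by (rule prob_space_std_normal_vec)

interpretation std_normal_mat: prob_space "std_normal_mat n p" for n p
  by (rule prob_space_std_normal_mat)

interpretation normal_prod: product_sigma_finite "\<lambda>_. std_normal"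
  by (intro product_sigma_finite.intro std_normal.sigma_finite_measure_axioms)

interpretation vec_prod: product_sigma_finite "\<lambda>_. std_normal_vec p" for p
  by (intro product_sigma_finite.intro std_normal_vec.sigma_finite_measure_axioms)

section \<open>Gaussian laws as densities over the standard normal law\<close>

lemma mvn_identity: "mvn p (1\<^sub>m p) = std_normal_vec p"
proof -
  have "std_normal_vec p = density (PiM {..<p} (\<lambda>_. lborel)) (\<lambda>x. \<Prod>j<p. ennreal (std_normal_density (x j)))"
    by (intro PiM_density) (auto intro: std_normal.sigma_finite_measure_axioms lborel.sigma_finite_measure_axioms)
  then show ?thesis by (simp add: mvn_def mvn_density_identity prod_ennreal)
qed

definition spiked_lr :: "nat \<Rightarrow> real \<Rightarrow> (nat \<Rightarrow> real) \<Rightarrow> (nat \<Rightarrow> real) \<Rightarrow> real" where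
  "spiked_lr p c v x = exp ((c / (1 + c)) * (\<Sum>j<p. v j * x j)\<^sup>2 / 2) / sqrt (1 + c)"

lemma spiked_lr_measurable [measurable]: "spiked_lr p c v \<in> borel_measurable (std_normal_vec p)"
  unfolding spiked_lr_def by measurable

lemma mvn_spiked_cov:
  assumes "(\<Sum>j<p. v j * v j) = 1" "c > -1"
  shows "mvn p (spiked_cov p c v) = density (std_normal_vec p) (\<lambda>x. ennreal (spiked_lr p c v x))"
proof -
  have [measurable]: "spiked_lr p c v \<in> borel_measurable (PiM {..<p} (\<lambda>_. lborel))"
    unfolding spiked_lr_def by measurable
  have [measurable]: "mvn_density p (1\<^sub>m p) \<in> borel_measurable (PiM {..<p} (\<lambda>_. lborel))"
    unfolding mvn_density_identity by measurable
  have "mvn p (spiked_cov p c v) = density (PiM {..<p} (\<lambda>_. lborel))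
     (\<lambda>x. ennreal (mvn_density p (1\<^sub>m p) x) * ennreal (spiked_lr p c v x))"
    unfolding mvn_def mvn_density_spiked_cov[OF assms] spiked_lr_def using assms(2)
    by (subst ennreal_mult'') auto
  then show ?thesis
    unfolding mvn_identity[symmetric] mvn_def by (subst density_density_eq) auto
qed

lemma nn_integral_std_normal_vec_exp_linear:
  "(\<integral>\<^sup>+x. ennreal (exp (\<Sum>j<p. t j * x j)) \<partial>std_normal_vec p) = ennreal (exp (\<Sum>j<p. (t j)\<^sup>2 / 2))"
  using normal_prod.product_nn_integral_prod[of "{..<p}" "\<lambda>j x. ennreal (exp (t j * x))"]
  by (simp add: nn_integral_std_normal_exp prod_ennreal exp_sum)

lemma std_normal_mat_entry_measurable:
  assumes "i \<in> {..<n}" "j \<in> {..<p}"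
  shows "(\<lambda>x. x i j) \<in> borel_measurable (std_normal_mat n p)"
  using measurable_compose[OF measurable_component_singleton[OF assms(1), of "\<lambda>_. std_normal_vec p"]
      measurable_component_singleton[OF assms(2), of "\<lambda>_. std_normal"]]
  by simp

lemma nn_integral_std_normal_mat_exp_linear:
  "(\<integral>\<^sup>+x. ennreal (exp (\<Sum>i<n. \<Sum>j<p. t i j * x i j)) \<partial>std_normal_mat n p)
     = ennreal (exp (\<Sum>i<n. \<Sum>j<p. (t i j)\<^sup>2 / 2))"
proof -
  have "(\<integral>\<^sup>+x. ennreal (exp (\<Sum>i<n. \<Sum>j<p. t i j * x i j)) \<partial>std_normal_mat n p)
      = (\<integral>\<^sup>+x. (\<Prod>i<n. ennreal (exp (\<Sum>j<p. t i j * x i j))) \<partial>std_normal_mat n p)"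
    by (simp add: exp_sum[of "{..<n}"] prod_ennreal)
  also have "\<dots> = (\<Prod>i<n. \<integral>\<^sup>+y. ennreal (exp (\<Sum>j<p. t i j * y j)) \<partial>std_normal_vec p)"
    by (intro vec_prod.product_nn_integral_prod) (simp, measurable)
  finally show ?thesis
    by (simp add: nn_integral_std_normal_vec_exp_linear prod_ennreal exp_sum[of "{..<n}"])
qed

text \<open>Given \<open>g\<close>, a row \<open>z + sqrt c * g * v\<close> with unit
  \<open>v\<close> is a shifted normal vector, whose likelihood ratio stands under the integral;
  averaging over \<open>g\<close> gives the spiked ratio.\<close>

lemma spiked_lr_eq_mixture:
  assumes "c \<ge> 0"
  shows "ennreal (spiked_lr p c v x)
    = (\<integral>\<^sup>+g. ennreal (exp (sqrt c * g * (\<Sum>j<p. v j * x j) - c * g\<^sup>2 / 2)) \<partial>std_normal)"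
  using nn_integral_std_normal_exp_quadratic[of c "sqrt c * (\<Sum>j<p. v j * x j)"] assms
  by (simp add: spiked_lr_def power_mult_distrib mult_ac)

text \<open>After exchanging the integrals, each shift likelihood ratio integrates to 1. With
  \<open>mvn_spiked_cov\<close> this makes the spiked law a probability measure.\<close>

lemma nn_integral_spiked_lr:
  assumes v: "(\<Sum>j<p. v j * v j) = 1" and c: "c \<ge> 0"
  shows "(\<integral>\<^sup>+x. ennreal (spiked_lr p c v x) \<partial>std_normal_vec p) = 1"
proof -
  interpret pair_sigma_finite std_normal "std_normal_vec p" ..
  have "(\<integral>\<^sup>+x. ennreal (spiked_lr p c v x) \<partial>std_normal_vec p)
      = (\<integral>\<^sup>+g. \<integral>\<^sup>+x. ennreal (exp (sqrt c * g * (\<Sum>j<p. v j * x j) - c * g\<^sup>2 / 2)) \<partial>std_normal_vec p \<partial>std_normal)"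
    unfolding spiked_lr_eq_mixture[OF c] by (rule Fubini') measurable
  also have "\<dots> = (\<integral>\<^sup>+g. 1 \<partial>std_normal)"
  proof (intro nn_integral_cong)
    fix g :: real
    have "(\<integral>\<^sup>+x. ennreal (exp (sqrt c * g * (\<Sum>j<p. v j * x j) - c * g\<^sup>2 / 2)) \<partial>std_normal_vec p)
        = (\<integral>\<^sup>+x. ennreal (exp (- c * g\<^sup>2 / 2)) * ennreal (exp (\<Sum>j<p. (sqrt c * g * v j) * x j)) \<partial>std_normal_vec p)"
      by (intro nn_integral_cong)
        (simp add: ennreal_mult[symmetric] mult_exp_exp sum_distrib_left mult_ac)
    also have "\<dots> = ennreal (exp (- c * g\<^sup>2 / 2)) * ennreal (exp (\<Sum>j<p. (sqrt c * g * v j)\<^sup>2 / 2))"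
      by (subst nn_integral_cmult, measurable) (simp add: nn_integral_std_normal_vec_exp_linear)
    also have "(\<Sum>j<p. (sqrt c * g * v j)\<^sup>2 / 2) = c * g\<^sup>2 / 2 * (\<Sum>j<p. v j * v j)"
      using c by (simp add: sum_distrib_left power_mult_distrib) (simp add: power2_eq_square mult_ac)
    finally show "(\<integral>\<^sup>+x. ennreal (exp (sqrt c * g * (\<Sum>j<p. v j * x j) - c * g\<^sup>2 / 2)) \<partial>std_normal_vec p) = 1"
      using v by (simp add: ennreal_mult[symmetric] mult_exp_exp)
  qed
  finally show ?thesis using std_normal.emeasure_space_1 by simp
qed

lemma prob_space_mvn_spiked_cov:
  assumes v: "(\<Sum>j<p. v j * v j) = 1" and c: "c \<ge> 0"
  shows "prob_space (mvn p (spiked_cov p c v))"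
  using nn_integral_spiked_lr[OF assms] c
  by (intro prob_spaceI) (simp add: mvn_spiked_cov[OF v] emeasure_density cong: nn_integral_cong)

lemma prob_space_sample_law:
  assumes v: "(\<Sum>j<p. v j * v j) = 1" and c: "c \<ge> 0"
  shows "prob_space (sample_law n p (spiked_cov p c v))"
  unfolding sample_law_def by (intro prob_space_PiM prob_space_mvn_spiked_cov assms)

lemma sample_law_identity: "sample_law n p (1\<^sub>m p) = std_normal_mat n p"
  by (simp add: sample_law_def mvn_identity)

lemma sample_law_spiked_cov:
  assumes v: "(\<Sum>j<p. v j * v j) = 1" and c: "c \<ge> 0"
  shows "sample_law n p (spiked_cov p c v)
    = density (std_normal_mat n p) (\<lambda>x. \<Prod>i<n. ennreal (spiked_lr p c v (x i)))"
proof -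
  have *: "mvn p (spiked_cov p c v) = density (std_normal_vec p) (\<lambda>x. ennreal (spiked_lr p c v x))"
    using mvn_spiked_cov[OF v] c by simp
  show ?thesis
    unfolding sample_law_def *
    using prob_space_mvn_spiked_cov[OF assms] unfolding *
    by (intro PiM_density) (auto intro: std_normal_vec.sigma_finite_measure_axioms prob_space_imp_sigma_finite)
qed

text \<open>The rows of a spiked sample are \<open>z\<^sub>i + sqrt c g\<^sub>i v\<close> with independent standard normal \<open>z\<^sub>i\<close>, \<open>g\<^sub>i\<close>;
  this is the likelihood ratio given \<open>g\<close>.\<close>

definition latent_lr ::
  "nat \<Rightarrow> nat \<Rightarrow> real \<Rightarrow> (nat \<Rightarrow> real) \<Rightarrow> (nat \<Rightarrow> real) \<Rightarrow> (nat \<Rightarrow> nat \<Rightarrow> real) \<Rightarrow> real" where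
  "latent_lr n p c v g x = exp (\<Sum>i<n. sqrt c * g i * (\<Sum>j<p. v j * x i j) - c * (g i)\<^sup>2 / 2)"

lemma latent_lr_measurable [measurable]:
  "(\<lambda>(g, x). latent_lr n p c v g x) \<in> borel_measurable (std_normal_vec n \<Otimes>\<^sub>M std_normal_mat n p)"
proof -
  have [measurable]: "(\<lambda>z. fst z i) \<in> borel_measurable (std_normal_vec n \<Otimes>\<^sub>M std_normal_mat n p)"
    if "i \<in> {..<n}" for i
    using measurable_compose[OF measurable_fst measurable_component_singleton[OF that, of "\<lambda>_. std_normal"]]
    by simp
  have [measurable]: "(\<lambda>z. snd z i j) \<in> borel_measurable (std_normal_vec n \<Otimes>\<^sub>M std_normal_mat n p)"
    if "i \<in> {..<n}" "j \<in> {..<p}" for i j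
    by (rule measurable_compose[OF measurable_snd std_normal_mat_entry_measurable[OF that]])
  show ?thesis unfolding latent_lr_def case_prod_beta by measurable
qed

text \<open>Up to a factor free of \<open>x\<close>, the integrand is the exponential of a linear
  form in \<open>x\<close>. The squares of \<open>g\<close> and \<open>h\<close> cancel because
  \<open>u\<close> and \<open>v\<close> are unit vectors; only the cross term remains, bracketed as
  a linear form in \<open>h\<close>.\<close>

lemma nn_integral_latent_lr_mult:
  assumes u: "(\<Sum>j<p. u j * u j) = 1" and v: "(\<Sum>j<p. v j * v j) = 1" and c: "c \<ge> 0"
  shows "(\<integral>\<^sup>+x. ennreal (latent_lr n p c u g x * latent_lr n p c v h x) \<partial>std_normal_mat n p)
    = ennreal (exp (\<Sum>i<n. (c * (\<Sum>j<p. u j * v j) * g i) * h i))"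
proof -
  note std_normal_mat_entry_measurable [measurable]
  define K where "K = (\<Sum>i<n. - (c / 2) * ((g i)\<^sup>2 + (h i)\<^sup>2))"
  have "latent_lr n p c u g x * latent_lr n p c v h x
      = exp K * exp (\<Sum>i<n. \<Sum>j<p. (sqrt c * (g i * u j + h i * v j)) * x i j)" for x
  proof -
    have "(\<Sum>i<n. sqrt c * g i * (\<Sum>j<p. u j * x i j) - c * (g i)\<^sup>2 / 2)
        + (\<Sum>i<n. sqrt c * h i * (\<Sum>j<p. v j * x i j) - c * (h i)\<^sup>2 / 2)
       = K + (\<Sum>i<n. \<Sum>j<p. (sqrt c * (g i * u j + h i * v j)) * x i j)"
      unfolding K_def sum.distrib[symmetric] sum_distrib_left
      by (intro sum.cong refl) (simp add: algebra_simps sum.distrib)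
    then show ?thesis by (simp add: latent_lr_def mult_exp_exp)
  qed
  then have "(\<integral>\<^sup>+x. ennreal (latent_lr n p c u g x * latent_lr n p c v h x) \<partial>std_normal_mat n p)
    = ennreal (exp K) * ennreal (exp (\<Sum>i<n. \<Sum>j<p. (sqrt c * (g i * u j + h i * v j))\<^sup>2 / 2))"
    by (subst nn_integral_std_normal_mat_exp_linear[symmetric], subst nn_integral_cmult[symmetric], measurable)
      (simp add: ennreal_mult)
  also have "\<dots> = ennreal (exp (K + (\<Sum>i<n. \<Sum>j<p. (sqrt c * (g i * u j + h i * v j))\<^sup>2 / 2)))"
    by (simp add: ennreal_mult[symmetric] mult_exp_exp)
  also have "K + (\<Sum>i<n. \<Sum>j<p. (sqrt c * (g i * u j + h i * v j))\<^sup>2 / 2)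
      = (\<Sum>i<n. (c * (\<Sum>j<p. u j * v j) * g i) * h i)"
    unfolding K_def sum.distrib[symmetric]
  proof (intro sum.cong refl)
    fix i
    have "(\<Sum>j<p. (sqrt c * (g i * u j + h i * v j))\<^sup>2 / 2)
        = (\<Sum>j<p. c / 2 * (g i)\<^sup>2 * (u j * u j) + c / 2 * (h i)\<^sup>2 * (v j * v j) + c * g i * h i * (u j * v j))"
      unfolding power_mult_distrib real_sqrt_pow2[OF c]
      by (intro sum.cong) (auto simp: power2_eq_square algebra_simps)
    also have "\<dots> = c / 2 * (g i)\<^sup>2 + c / 2 * (h i)\<^sup>2 + c * g i * h i * (\<Sum>j<p. u j * v j)"
      by (simp only: sum.distrib sum_distrib_left[symmetric] u v mult_1_right)
    finally show "- (c / 2) * ((g i)\<^sup>2 + (h i)\<^sup>2) + (\<Sum>j<p. (sqrt c * (g i * u j + h i * v j))\<^sup>2 / 2)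
        = c * (\<Sum>j<p. u j * v j) * g i * h i"
      by (simp add: algebra_simps)
  qed
  finally show ?thesis .
qed

text \<open>Taking \<open>h = 0\<close> turns the second factor of the product formula into
  1.\<close>

lemma nn_integral_latent_lr:
  assumes v: "(\<Sum>j<p. v j * v j) = 1" and c: "c \<ge> 0"
  shows "(\<integral>\<^sup>+x. ennreal (latent_lr n p c v g x) \<partial>std_normal_mat n p) = 1"
  using nn_integral_latent_lr_mult[OF v v c, of n g "\<lambda>_. 0"] by (simp add: latent_lr_def)

text \<open>Without truncating \<open>g\<close> the second moment of the likelihood ratio is infinite at \<open>c = 1\<close>.\<close>

definition truncated_lr ::
  "nat \<Rightarrow> nat \<Rightarrow> real \<Rightarrow> real \<Rightarrow> (nat \<Rightarrow> real) \<Rightarrow> (nat \<Rightarrow> nat \<Rightarrow> real) \<Rightarrow> real" where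
  "truncated_lr n p c M v x = enn2real
     (\<integral>\<^sup>+g. indicator {g. (\<Sum>i<n. (g i)\<^sup>2) \<le> M} g * ennreal (latent_lr n p c v g x) \<partial>std_normal_vec n)"

lemma truncation_measurable [measurable]:
  "(indicator {g. (\<Sum>i<n. (g i)\<^sup>2) \<le> M} :: _ \<Rightarrow> ennreal) \<in> borel_measurable (std_normal_vec n)"
proof -
  have "{g \<in> space (std_normal_vec n). (\<Sum>i<n. (g i)\<^sup>2) \<le> M} \<in> sets (std_normal_vec n)"
    by measurable
  then show ?thesis by (subst borel_measurable_indicator_iff) (simp add: Int_def conj_commute)
qed

text \<open>Dropping the indicator leaves a product integral over independent \<open>g i\<close>,
  one mixture formula per row.\<close>

lemma nn_integral_truncated_le:
  assumes c: "c \<ge> 0"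
  shows "(\<integral>\<^sup>+g. indicator {g. (\<Sum>i<n. (g i)\<^sup>2) \<le> M} g * ennreal (latent_lr n p c v g x) \<partial>std_normal_vec n)
     \<le> (\<Prod>i<n. ennreal (spiked_lr p c v (x i)))"
proof -
  have "(\<integral>\<^sup>+g. indicator {g. (\<Sum>i<n. (g i)\<^sup>2) \<le> M} g * ennreal (latent_lr n p c v g x) \<partial>std_normal_vec n)
     \<le> (\<integral>\<^sup>+g. (\<Prod>i<n. ennreal (exp (sqrt c * g i * (\<Sum>j<p. v j * x i j) - c * (g i)\<^sup>2 / 2))) \<partial>std_normal_vec n)"
    by (intro nn_integral_mono) (auto simp: indicator_def latent_lr_def exp_sum prod_ennreal)
  also have "\<dots> = (\<Prod>i<n. ennreal (spiked_lr p c v (x i)))"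
    unfolding spiked_lr_eq_mixture[OF c] by (intro normal_prod.product_nn_integral_prod) auto
  finally show ?thesis .
qed

text \<open>The truncated integral lies below the finite full likelihood ratio, so
  \<open>enn2real\<close> loses nothing.\<close>

lemma ennreal_truncated_lr:
  assumes c: "c \<ge> 0"
  shows "ennreal (truncated_lr n p c M v x)
    = (\<integral>\<^sup>+g. indicator {g. (\<Sum>i<n. (g i)\<^sup>2) \<le> M} g * ennreal (latent_lr n p c v g x) \<partial>std_normal_vec n)"
  unfolding truncated_lr_def
proof (rule ennreal_enn2real, unfold infinity_ennreal_def[symmetric])
  have "(\<Prod>i<n. ennreal (spiked_lr p c v (x i))) < \<infinity>"
    by (simp add: less_top[symmetric] ennreal_prod_eq_top)
  then show "(\<integral>\<^sup>+g. indicator {g. (\<Sum>i<n. (g i)\<^sup>2) \<le> M} g * ennreal (latent_lr n p c v g x) \<partial>std_normal_vec n) < \<infinity>"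
    by (rule order.strict_trans1[OF nn_integral_truncated_le[OF c]])
qed

lemma truncated_lr_nonneg: "0 \<le> truncated_lr n p c M v x"
  by (simp add: truncated_lr_def)

lemma truncated_lr_measurable [measurable]:
  "truncated_lr n p c M v \<in> borel_measurable (std_normal_mat n p)"
  unfolding truncated_lr_def by measurable

text \<open>Each \<open>latent_lr\<close> has mean 1, so the mass kept is the probability of the
  truncation event.\<close>

lemma nn_integral_truncated_lr:
  assumes v: "(\<Sum>j<p. v j * v j) = 1" and c: "c \<ge> 0"
  shows "(\<integral>\<^sup>+x. ennreal (truncated_lr n p c M v x) \<partial>std_normal_mat n p)
    = (\<integral>\<^sup>+g. indicator {g. (\<Sum>i<n. (g i)\<^sup>2) \<le> M} g \<partial>std_normal_vec n)"
proof -
  interpret pair_sigma_finite "std_normal_vec n" "std_normal_mat n p" ..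
  let ?i = "\<lambda>g. indicator {g. (\<Sum>i<n. (g i)\<^sup>2) \<le> M} g :: ennreal"
  have "(\<integral>\<^sup>+x. ennreal (truncated_lr n p c M v x) \<partial>std_normal_mat n p)
      = (\<integral>\<^sup>+g. \<integral>\<^sup>+x. ?i g * ennreal (latent_lr n p c v g x) \<partial>std_normal_mat n p \<partial>std_normal_vec n)"
    unfolding ennreal_truncated_lr[OF c] by (rule Fubini') measurable
  also have "\<dots> = (\<integral>\<^sup>+g. ?i g \<partial>std_normal_vec n)"
    by (intro nn_integral_cong, subst nn_integral_cmult) (auto simp: nn_integral_latent_lr[OF assms])
  finally show ?thesis .
qed

text \<open>Dropping one of the two truncations makes the inner integral Gaussian; the other one bounds it.\<close>

lemma nn_integral_truncated_lr_mult_le: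
  assumes u: "(\<Sum>j<p. u j * u j) = 1" and v: "(\<Sum>j<p. v j * v j) = 1" and c: "c \<ge> 0"
  shows "(\<integral>\<^sup>+x. ennreal (truncated_lr n p c M u x * truncated_lr n p c M v x) \<partial>std_normal_mat n p)
    \<le> ennreal (exp (c\<^sup>2 * M * (\<Sum>j<p. u j * v j)\<^sup>2 / 2))"
proof -
  interpret pair_sigma_finite "std_normal_vec n" "std_normal_mat n p" ..
  let ?i = "\<lambda>g. indicator {g. (\<Sum>i<n. (g i)\<^sup>2) \<le> M} g :: ennreal"
  let ?T = "truncated_lr n p c M" and ?l = "latent_lr n p c"
  define s where "s = (\<Sum>j<p. u j * v j)"
  have "(\<integral>\<^sup>+x. ennreal (?T u x * ?T v x) \<partial>std_normal_mat n p)
      = (\<integral>\<^sup>+x. \<integral>\<^sup>+g. ?i g * ennreal (?l u g x) * ennreal (?T v x) \<partial>std_normal_vec n \<partial>std_normal_mat n p)"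
    by (intro nn_integral_cong, subst nn_integral_multc)
      (auto simp: ennreal_mult truncated_lr_nonneg ennreal_truncated_lr[OF c])
  also have "\<dots> = (\<integral>\<^sup>+g. \<integral>\<^sup>+x. ?i g * ennreal (?l u g x) * ennreal (?T v x) \<partial>std_normal_mat n p \<partial>std_normal_vec n)"
    by (rule Fubini') measurable
  also have "\<dots> \<le> (\<integral>\<^sup>+g. ennreal (exp (c\<^sup>2 * M * s\<^sup>2 / 2)) \<partial>std_normal_vec n)"
  proof (intro nn_integral_mono)
    fix g assume g [measurable]: "g \<in> space (std_normal_vec n)"
    have "(\<integral>\<^sup>+x. ennreal (?l u g x) * ennreal (?T v x) \<partial>std_normal_mat n p)
        = (\<integral>\<^sup>+x. \<integral>\<^sup>+h. ennreal (?l u g x) * (?i h * ennreal (?l v h x)) \<partial>std_normal_vec n \<partial>std_normal_mat n p)"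
      by (intro nn_integral_cong, subst nn_integral_cmult) (auto simp: ennreal_truncated_lr[OF c])
    also have "\<dots> = (\<integral>\<^sup>+h. \<integral>\<^sup>+x. ennreal (?l u g x) * (?i h * ennreal (?l v h x)) \<partial>std_normal_mat n p \<partial>std_normal_vec n)"
      by (rule Fubini') measurable
    \<comment> \<open>Only the truncation of \<open>h\<close> is dropped here; that of
      \<open>g\<close> stays outside this integral.\<close>
    also have "\<dots> \<le> (\<integral>\<^sup>+h. \<integral>\<^sup>+x. ennreal (?l u g x * ?l v h x) \<partial>std_normal_mat n p \<partial>std_normal_vec n)"
      by (intro nn_integral_mono) (auto simp: indicator_def ennreal_mult latent_lr_def)
    \<comment> \<open>Integrating out \<open>x\<close> leaves an exponent linear in
      \<open>h\<close>, and integrating out \<open>h\<close> squares its coefficients.\<close>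
    also have "\<dots> = ennreal (exp (\<Sum>i<n. (c * s * g i)\<^sup>2 / 2))"
      by (simp only: nn_integral_latent_lr_mult[OF u v c] s_def[symmetric]
          nn_integral_std_normal_vec_exp_linear[where t = "\<lambda>i. c * s * g i"])
    finally have inner: "(\<integral>\<^sup>+x. ennreal (?l u g x) * ennreal (?T v x) \<partial>std_normal_mat n p)
        \<le> ennreal (exp (c\<^sup>2 * s\<^sup>2 / 2 * (\<Sum>i<n. (g i)\<^sup>2)))"
      by (simp add: power_mult_distrib sum_distrib_left)
    have "(\<integral>\<^sup>+x. ?i g * ennreal (?l u g x) * ennreal (?T v x) \<partial>std_normal_mat n p)
        = ?i g * (\<integral>\<^sup>+x. ennreal (?l u g x) * ennreal (?T v x) \<partial>std_normal_mat n p)"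
      by (subst nn_integral_cmult[symmetric]) (auto simp: mult.assoc)
    also have "\<dots> \<le> ?i g * ennreal (exp (c\<^sup>2 * s\<^sup>2 / 2 * (\<Sum>i<n. (g i)\<^sup>2)))"
      using inner by (rule mult_left_mono) simp
    also have "\<dots> \<le> ennreal (exp (c\<^sup>2 * M * s\<^sup>2 / 2))"
    proof (cases "(\<Sum>i<n. (g i)\<^sup>2) \<le> M")
      case True
      then have "c\<^sup>2 * s\<^sup>2 / 2 * (\<Sum>i<n. (g i)\<^sup>2) \<le> c\<^sup>2 * s\<^sup>2 / 2 * M" by (intro mult_left_mono) auto
      then show ?thesis using True by (simp add: mult_ac)
    qed simp
    finally show "(\<integral>\<^sup>+x. ?i g * ennreal (?l u g x) * ennreal (?T v x) \<partial>std_normal_mat n p)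
        \<le> ennreal (exp (c\<^sup>2 * M * s\<^sup>2 / 2))" .
  qed
  also have "\<dots> = ennreal (exp (c\<^sup>2 * M * s\<^sup>2 / 2))" using std_normal_vec.emeasure_space_1 by simp
  finally show ?thesis by (simp add: s_def)
qed

text \<open>Markov's inequality, integrated from its pointwise form; the squares have mean 1. For
  \<open>M < n\<close> the left side is 0, as \<open>ennreal\<close> sends negative numbers to
  0.\<close>

lemma truncation_mass_ge:
  assumes "0 < M"
  shows "ennreal (1 - real n / M) \<le> (\<integral>\<^sup>+g. indicator {g. (\<Sum>i<n. (g i)\<^sup>2) \<le> M} g \<partial>std_normal_vec n)"
proof -
  let ?i = "\<lambda>g. indicator {g. (\<Sum>i<n. (g i)\<^sup>2) \<le> M} g :: ennreal"
  have "(\<integral>\<^sup>+g. ennreal ((g i)\<^sup>2) \<partial>std_normal_vec n) = 1" if "i < n" for i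
  proof -
    have "(\<integral>\<^sup>+g. ennreal ((g i)\<^sup>2) \<partial>std_normal_vec n)
        = (\<integral>\<^sup>+x. ennreal (x\<^sup>2) \<partial>distr (std_normal_vec n) std_normal (\<lambda>g. g i))"
      using that by (subst nn_integral_distr) (auto intro!: measurable_component_singleton)
    also have "distr (std_normal_vec n) std_normal (\<lambda>g. g i) = std_normal"
      using that by (intro distr_PiM_component std_normal.prob_space_axioms) auto
    finally show ?thesis by (simp add: nn_integral_std_normal_square)
  qed
  then have E: "(\<integral>\<^sup>+g. (\<Sum>i<n. ennreal ((g i)\<^sup>2)) \<partial>std_normal_vec n) = of_nat n"
    by (subst nn_integral_sum) auto
  have "1 = (\<integral>\<^sup>+g. 1 \<partial>std_normal_vec n)" using std_normal_vec.emeasure_space_1 by simp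
  also have "\<dots> \<le> (\<integral>\<^sup>+g. ?i g + ennreal (1 / M) * (\<Sum>i<n. ennreal ((g i)\<^sup>2)) \<partial>std_normal_vec n)"
  proof (intro nn_integral_mono)
    fix g
    show "1 \<le> ?i g + ennreal (1 / M) * (\<Sum>i<n. ennreal ((g i)\<^sup>2))"
      using assms by (auto simp: indicator_def sum_nonneg field_simps simp flip: ennreal_mult ennreal_1
          intro!: ennreal_leI)
  qed
  also have "\<dots> = (\<integral>\<^sup>+g. ?i g \<partial>std_normal_vec n) + ennreal (1 / M) * of_nat n"
    by (subst nn_integral_add) (auto simp: nn_integral_cmult E simp del: sum_ennreal)
  also have "ennreal (1 / M) * of_nat n = ennreal (real n / M)"
    using assms by (simp add: ennreal_of_nat_eq_real_of_nat ennreal_mult[symmetric])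
  finally have "1 - ennreal (real n / M) \<le> (\<integral>\<^sup>+g. ?i g \<partial>std_normal_vec n)"
    by (simp add: ennreal_minus_le_iff add.commute)
  then show ?thesis using assms by (simp add: ennreal_minus[symmetric])
qed

section \<open>Testing error\<close>

text \<open>With \<open>Z\<close> the truncated mixture likelihood ratio, this expectation bounds
  the testing error from below. Both bounds replace \<open>min 1 z\<close> by a quadratic minorant:
  the first is positive whenever \<open>\<mu>\<close> is, the second tends to 1 as
  \<open>\<mu>\<close> and \<open>C\<close> do.\<close>

lemma (in prob_space) expectation_min_one_ge:
  fixes Z :: "'a \<Rightarrow> real"
  assumes Z [measurable]: "Z \<in> borel_measurable M" and nonneg: "\<And>x. 0 \<le> Z x"
    and mean: "ennreal \<mu> \<le> (\<integral>\<^sup>+x. ennreal (Z x) \<partial>M)"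
    and second: "(\<integral>\<^sup>+x. ennreal ((Z x)\<^sup>2) \<partial>M) \<le> ennreal C"
    and \<mu>: "0 \<le> \<mu>" "\<mu> \<le> 1" and C: "1 \<le> C"
  shows "3 / 4 * \<mu>\<^sup>2 / C \<le> expectation (\<lambda>x. min 1 (Z x))"
    and "0 < 1 - 2 * \<mu> + C \<Longrightarrow> 1 - sqrt (1 - 2 * \<mu> + C) \<le> expectation (\<lambda>x. min 1 (Z x))"
proof -
  have Z2 [simp]: "integrable M (\<lambda>x. (Z x)\<^sup>2)"
    using second by (intro integrableI_bounded) (auto simp: top_unique less_top[symmetric] infinity_ennreal_def)
  have Z1 [simp]: "integrable M Z"
    by (rule square_integrable_imp_integrable[OF Z Z2])
  have min_int [simp]: "integrable M (\<lambda>x. min 1 (Z x))" by auto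
  have E1: "\<mu> \<le> expectation Z"
  proof -
    have "ennreal \<mu> \<le> ennreal (expectation Z)"
      using mean nn_integral_eq_integral[OF Z1] nonneg by simp
    then show ?thesis using nonneg by (subst (asm) ennreal_le_iff) (auto intro: integral_nonneg)
  qed
  have E2: "expectation (\<lambda>x. (Z x)\<^sup>2) \<le> C"
  proof -
    have "ennreal (expectation (\<lambda>x. (Z x)\<^sup>2)) \<le> ennreal C"
      using second nn_integral_eq_integral[OF Z2] by simp
    then show ?thesis using C by (subst (asm) ennreal_le_iff) auto
  qed
  show "3 / 4 * \<mu>\<^sup>2 / C \<le> expectation (\<lambda>x. min 1 (Z x))"
  proof -
    \<comment> \<open>The bound \<open>\<alpha> * \<mu> - \<alpha>\<^sup>2 / 4 * C\<close> is
      largest at \<open>2 * \<mu> / C\<close>; half of that is taken because the comparison with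
      \<open>Z x\<close> uses \<open>\<alpha> \<le> 1\<close>.\<close>
    define \<alpha> where "\<alpha> = \<mu> / C"
    have \<alpha>: "0 \<le> \<alpha>" "\<alpha> \<le> 1" using \<mu> C by (auto simp: \<alpha>_def field_simps)
    have "3 / 4 * \<mu>\<^sup>2 / C = \<alpha> * \<mu> - \<alpha>\<^sup>2 / 4 * C"
      using C by (simp add: \<alpha>_def field_simps power2_eq_square)
    also have "\<dots> \<le> \<alpha> * expectation Z - \<alpha>\<^sup>2 / 4 * expectation (\<lambda>x. (Z x)\<^sup>2)"
      using E1 E2 \<alpha> by (intro diff_mono mult_left_mono) auto
    also have "\<dots> = expectation (\<lambda>x. \<alpha> * Z x - \<alpha>\<^sup>2 / 4 * (Z x)\<^sup>2)"
      by simp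
    also have "\<dots> \<le> expectation (\<lambda>x. min 1 (Z x))"
    proof (intro integral_mono min.boundedI)
      fix x
      have "0 \<le> (1 - \<alpha> * Z x / 2)\<^sup>2" by simp
      then show "\<alpha> * Z x - \<alpha>\<^sup>2 / 4 * (Z x)\<^sup>2 \<le> 1" by (simp add: power2_eq_square algebra_simps)
      have "\<alpha> * Z x \<le> 1 * Z x" using \<alpha> nonneg by (intro mult_right_mono) auto
      moreover have "0 \<le> \<alpha>\<^sup>2 / 4 * (Z x)\<^sup>2" by simp
      ultimately show "\<alpha> * Z x - \<alpha>\<^sup>2 / 4 * (Z x)\<^sup>2 \<le> Z x" by linarith
    qed auto
    finally show ?thesis .
  qed
  show "1 - sqrt (1 - 2 * \<mu> + C) \<le> expectation (\<lambda>x. min 1 (Z x))" if pos: "0 < 1 - 2 * \<mu> + C"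
  proof -
    \<comment> \<open>\<open>1 - 2 * \<mu> + C\<close> bounds the mean of
      \<open>(1 - Z)\<^sup>2\<close>, and this \<open>t\<close> balances the two subtracted terms
      below.\<close>
    define t where "t = sqrt (1 - 2 * \<mu> + C)"
    have t: "0 < t" "t\<^sup>2 = 1 - 2 * \<mu> + C" using pos by (auto simp: t_def)
    have "1 - t = 1 - t / 2 - (1 - 2 * \<mu> + C) / (2 * t)"
      using t by (simp add: field_simps power2_eq_square)
    also have "\<dots> \<le> 1 - t / 2 - (1 - 2 * expectation Z + expectation (\<lambda>x. (Z x)\<^sup>2)) / (2 * t)"
      using E1 E2 t by (intro diff_left_mono divide_right_mono) auto
    also have "\<dots> = expectation (\<lambda>x. 1 - t / 2 - (1 - 2 * Z x + (Z x)\<^sup>2) / (2 * t))"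
      by (simp add: prob_space)
    also have "\<dots> \<le> expectation (\<lambda>x. min 1 (Z x))"
    proof (intro integral_mono min.boundedI)
      fix x
      have sq: "1 - 2 * Z x + (Z x)\<^sup>2 = (1 - Z x)\<^sup>2" by (simp add: power2_eq_square algebra_simps)
      have "0 \<le> (1 - Z x)\<^sup>2 / (2 * t)" using t by simp
      then show "1 - t / 2 - (1 - 2 * Z x + (Z x)\<^sup>2) / (2 * t) \<le> 1" unfolding sq using t by linarith
      have "0 \<le> (t - (1 - Z x))\<^sup>2" by simp
      then have "2 * t * (1 - Z x) \<le> t * t + (1 - Z x)\<^sup>2" by (simp add: power2_eq_square algebra_simps)
      then have "1 - Z x \<le> t / 2 + (1 - Z x)\<^sup>2 / (2 * t)" using t by (simp add: field_simps)
      then show "1 - t / 2 - (1 - 2 * Z x + (Z x)\<^sup>2) / (2 * t) \<le> Z x" unfolding sq by linarith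
    qed auto
    finally show ?thesis by (simp add: t_def)
  qed
qed

lemma spiked_covariancesE:
  assumes "S \<in> spiked_covariances p k lam"
  obtains v where "(\<Sum>j<p. v j * v j) = 1" "S = spiked_cov p lam v"
proof -
  obtain w where w: "S = 1\<^sub>m p + lam \<cdot>\<^sub>m outer_product w" "w \<in> carrier_vec p" "scalar_prod w w = 1"
    using assms by (auto simp: spiked_covariances_def unit_sphere_def)
  have "Matrix.vec p (vec_index w) = w" using w by auto
  then show ?thesis
    using w by (intro that[of "vec_index w"]) (auto simp: spiked_cov_def scalar_prod_def atLeast0LessThan)
qed

lemma tests_measurable:
  assumes "\<phi> \<in> tests n p"
  shows "\<phi> \<in> measurable (std_normal_mat n p) (count_space {0, 1})"
proof -
  \<comment> \<open>Densities over \<open>lborel\<close> keep its sets, so both products carry the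
    Borel sets.\<close>
  have "sets (std_normal_mat n p) = sets (data_space n p)"
    unfolding data_space_def by (intro sets_PiM_cong refl) (simp cong: sets_PiM_cong)
  then show ?thesis
    using assms unfolding tests_def by (subst measurable_cong_sets[OF _ refl])
qed

lemma test_event_measurable:
  assumes "\<phi> \<in> tests n p"
  shows "{x \<in> space (std_normal_mat n p). \<phi> x = a} \<in> sets (std_normal_mat n p)"
proof -
  note \<phi> = tests_measurable[OF assms]
  \<comment> \<open>The intersection makes the target a subset of \<open>{0, 1}\<close> for every
    \<open>a\<close>.\<close>
  then have "\<phi> -` ({a} \<inter> {0, 1}) \<inter> space (std_normal_mat n p) \<in> sets (std_normal_mat n p)"
    by (rule measurable_sets) auto
  moreover have "\<phi> -` ({a} \<inter> {0, 1}) \<inter> space (std_normal_mat n p) = {x \<in> space (std_normal_mat n p). \<phi> x = a}"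
    using measurable_space[OF \<phi>] by auto
  ultimately show ?thesis by simp
qed

lemma integrable_truncated_lr:
  assumes v: "(\<Sum>j<p. v j * v j) = 1" and c: "c \<ge> 0"
  shows "integrable (std_normal_mat n p) (truncated_lr n p c M v)"
proof (rule integrableI_bounded)
  have "(\<integral>\<^sup>+g. indicator {g. (\<Sum>i<n. (g i)\<^sup>2) \<le> M} g \<partial>std_normal_vec n) \<le> (\<integral>\<^sup>+g. 1 \<partial>std_normal_vec n)"
    by (intro nn_integral_mono) (auto simp: indicator_def)
  also have "\<dots> < \<infinity>" using std_normal_vec.emeasure_space_1 by simp
  finally show "(\<integral>\<^sup>+x. ennreal (norm (truncated_lr n p c M v x)) \<partial>std_normal_mat n p) < \<infinity>"
    using nn_integral_truncated_lr[OF v c] by (simp add: truncated_lr_nonneg)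
qed simp

text \<open>The truncated ratio is a sub-density of the spiked law, by
  \<open>nn_integral_truncated_le\<close>.\<close>

lemma integral_truncated_lr_le_prob_test_eq:
  assumes v: "(\<Sum>j<p. v j * v j) = 1" and c: "c \<ge> 0" and \<phi>: "\<phi> \<in> tests n p"
  shows "(\<integral>x. truncated_lr n p c M v x * indicator {x \<in> space (std_normal_mat n p). \<phi> x = a} x \<partial>std_normal_mat n p)
    \<le> prob_test_eq n p (spiked_cov p c v) \<phi> a"
proof -
  let ?P = "sample_law n p (spiked_cov p c v)" and ?N = "std_normal_mat n p"
  let ?E = "{x \<in> space ?N. \<phi> x = a}"
  interpret P: prob_space ?P by (rule prob_space_sample_law[OF v c])
  have E [measurable]: "?E \<in> sets ?N" by (rule test_event_measurable[OF \<phi>])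
  have [measurable]: "(\<lambda>x. \<Prod>i<n. ennreal (spiked_lr p c v (x i))) \<in> borel_measurable ?N"
    by measurable
  have "ennreal (\<integral>x. truncated_lr n p c M v x * indicator ?E x \<partial>?N)
      = (\<integral>\<^sup>+x. ennreal (truncated_lr n p c M v x * indicator ?E x) \<partial>?N)"
    by (intro nn_integral_eq_integral[symmetric] integrable_real_mult_indicator integrable_truncated_lr v c E)
      (auto simp: truncated_lr_nonneg)
  also have "\<dots> \<le> (\<integral>\<^sup>+x. (\<Prod>i<n. ennreal (spiked_lr p c v (x i))) * indicator ?E x \<partial>?N)"
    using nn_integral_truncated_le[OF c, of n M p v]
    by (intro nn_integral_mono) (auto simp: ennreal_truncated_lr[OF c] indicator_def)
  also have "\<dots> = emeasure ?P ?E"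
    unfolding sample_law_spiked_cov[OF v c] by (subst emeasure_density) auto
  also have "\<dots> = ennreal (prob_test_eq n p (spiked_cov p c v) \<phi> a)"
  proof -
    have "space ?P = space ?N" unfolding sample_law_spiked_cov[OF v c] by simp
    then show ?thesis by (simp add: prob_test_eq_def P.emeasure_eq_measure)
  qed
  finally show ?thesis by (subst (asm) ennreal_le_iff) (auto simp: prob_test_eq_def)
qed

text \<open>With \<open>Z\<close> the averaged ratio, \<open>min 1 Z\<close> is at most 1 where the
  test rejects and at most \<open>Z\<close> where it accepts; integrating gives the two
  errors.\<close>

lemma bayes_testing_error_ge:
  assumes F: "finite F" "F \<noteq> {}" and v: "\<And>f. f \<in> F \<Longrightarrow> (\<Sum>j<p. v f j * v f j) = 1" and c: "c \<ge> 0"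
    and \<phi>: "\<phi> \<in> tests n p"
  shows "(\<integral>x. min 1 ((\<Sum>f\<in>F. truncated_lr n p c M (v f) x) / card F) \<partial>std_normal_mat n p)
    \<le> prob_test_eq n p (1\<^sub>m p) \<phi> 1 + (\<Sum>f\<in>F. prob_test_eq n p (spiked_cov p c (v f)) \<phi> 0) / card F"
proof -
  let ?N = "std_normal_mat n p" and ?T = "\<lambda>f. truncated_lr n p c M (v f)"
  let ?E = "\<lambda>a. {x \<in> space ?N. \<phi> x = a}"
  have E [measurable]: "?E a \<in> sets ?N" for a by (rule test_event_measurable[OF \<phi>])
  have [simp]: "integrable ?N (?T f)" if "f \<in> F" for f
    by (intro integrable_truncated_lr v that c)
  have int [simp]: "integrable ?N (\<lambda>x. ?T f x * indicator (?E a) x)" if "f \<in> F" for f a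
    using that by (intro integrable_real_mult_indicator) auto
  have ind [simp]: "integrable ?N (indicator (?E a) :: _ \<Rightarrow> real)" for a
    by (intro integrable_real_indicator E) (simp add: std_normal_mat.emeasure_eq_measure)
  have "(\<integral>x. min 1 ((\<Sum>f\<in>F. ?T f x) / card F) \<partial>?N)
     \<le> (\<integral>x. indicator (?E 1) x + (\<Sum>f\<in>F. ?T f x * indicator (?E 0) x) / card F \<partial>?N)"
  proof (rule integral_mono)
    fix x assume x: "x \<in> space ?N"
    have "\<phi> x = 0 \<or> \<phi> x = 1"
      using measurable_space[OF tests_measurable[OF \<phi>] x] by simp
    then show "min 1 ((\<Sum>f\<in>F. ?T f x) / card F)
        \<le> indicator (?E 1) x + (\<Sum>f\<in>F. ?T f x * indicator (?E 0) x) / card F"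
      using x by auto
  qed (auto intro!: integrable_min Bochner_Integration.integrable_add)
  also have "\<dots> = measure ?N (?E 1) + (\<Sum>f\<in>F. (\<integral>x. ?T f x * indicator (?E 0) x \<partial>?N)) / card F"
    by (subst Bochner_Integration.integral_add) auto
  also have "\<dots> \<le> measure ?N (?E 1) + (\<Sum>f\<in>F. prob_test_eq n p (spiked_cov p c (v f)) \<phi> 0) / card F"
    by (intro add_left_mono divide_right_mono sum_mono integral_truncated_lr_le_prob_test_eq v c \<phi>) auto
  finally show ?thesis by (simp add: prob_test_eq_def sample_law_identity)
qed

text \<open>The supremum is at least the average over the block prior. Being taken in the reals, it
  needs the boundedness from \<open>le_1\<close>, and the infimum needs a test to exist.\<close>

lemma minimax_testing_error_ge:
  assumes k: "1 \<le> k" "k \<le> p" and c: "c \<ge> 0"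
  defines "F \<equiv> block_patterns k (p div k)"
  shows "(\<integral>x. min 1 ((\<Sum>f\<in>F. truncated_lr n p c M (block_vec k (p div k) f) x) / card F) \<partial>std_normal_mat n p)
    \<le> minimax_testing_error n p k c"
proof -
  let ?v = "block_vec k (p div k)"
  have m: "0 < p div k" "k * (p div k) \<le> p" "0 < k" using k by (auto simp: div_greater_zero_iff)
  have card: "0 < card F" using m by (simp add: F_def card_block_patterns)
  have F: "finite F" "F \<noteq> {}" using card by (auto simp: F_def)
  have v: "(\<Sum>j<p. ?v f j * ?v f j) = 1" if "f \<in> F" for f
    using that m unfolding F_def by (intro block_vec_norm) auto
  have le_1: "prob_test_eq n p S \<phi> a \<le> 1" if S: "S \<in> spiked_covariances p k c" for S \<phi> a
  proof -
    obtain v where "(\<Sum>j<p. v j * v j) = 1" "S = spiked_cov p c v"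
      using S by (rule spiked_covariancesE)
    then interpret prob_space "sample_law n p S" using prob_space_sample_law c by simp
    show ?thesis by (simp add: prob_test_eq_def)
  qed
  show ?thesis
    unfolding minimax_testing_error_def
  proof (rule cINF_greatest)
    have "(\<lambda>_. 0) \<in> tests n p" by (simp add: tests_def)
    then show "tests n p \<noteq> {}" by blast
    fix \<phi> assume \<phi>: "\<phi> \<in> tests n p"
    let ?sup = "SUP S\<in>spiked_covariances p k c. prob_test_eq n p S \<phi> 0"
    have "(\<Sum>f\<in>F. prob_test_eq n p (spiked_cov p c (?v f)) \<phi> 0) \<le> (\<Sum>f\<in>F. ?sup)"
    proof (intro sum_mono cSUP_upper)
      fix f assume "f \<in> F"
      then show "spiked_cov p c (?v f) \<in> spiked_covariances p k c"
        using m unfolding F_def by (intro block_vec_mem_spiked_covariances) auto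
      show "bdd_above ((\<lambda>S. prob_test_eq n p S \<phi> 0) ` spiked_covariances p k c)"
        using le_1 by (intro bdd_aboveI2[where M = 1])
    qed
    then have "(\<Sum>f\<in>F. prob_test_eq n p (spiked_cov p c (?v f)) \<phi> 0) / card F \<le> ?sup"
      using card by (simp add: field_simps)
    then show "(\<integral>x. min 1 ((\<Sum>f\<in>F. truncated_lr n p c M (?v f) x) / card F) \<partial>std_normal_mat n p)
        \<le> prob_test_eq n p (1\<^sub>m p) \<phi> 1 + ?sup"
      using bayes_testing_error_ge[where v = ?v and M = M, OF F v c \<phi>] by linarith
  qed
qed

section \<open>Moments of the truncated mixture\<close>

text \<open>The square expands into pairs of patterns; \<open>bound\<close> turns the exponent of
  each pair into \<open>a * L / k * W\<^sup>2\<close>, and for fixed \<open>f\<close> the sum over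
  \<open>h\<close> is \<open>sum_exp_overlap_square_le\<close>.\<close>

lemma truncated_mixture_second_moment:
  assumes k: "1 \<le> k" "k \<le> p" and c: "c \<ge> 0" and M: "0 \<le> M"
    and a: "0 \<le> a" "36 * a < 1"
    and bound: "c\<^sup>2 * M \<le> 2 * a * real k * ln (exp 1 * real p / real k)"
  defines "F \<equiv> block_patterns k (p div k)"
  shows "(\<integral>\<^sup>+x. ennreal (((\<Sum>f\<in>F. truncated_lr n p c M (block_vec k (p div k) f) x) / card F)\<^sup>2) \<partial>std_normal_mat n p)
    \<le> ennreal (1 / sqrt (1 - 36 * a))"
proof -
  define m where "m = p div k"
  let ?v = "block_vec k m" and ?N = "std_normal_mat n p"
  let ?T = "\<lambda>f. truncated_lr n p c M (?v f)"
  define L where "L = ln (exp 1 * real p / real k)"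
  have m: "0 < m" "k * m \<le> p" "0 < k" using k by (auto simp: m_def div_greater_zero_iff)
  have cardF: "card F = (2 * m) ^ k" by (simp add: F_def m_def card_block_patterns)
  then have card: "0 < card F" using m by simp
  have v: "(\<Sum>j<p. ?v f j * ?v f j) = 1" if "f \<in> F" for f
    using that m unfolding F_def m_def by (intro block_vec_norm) auto
  have expL: "exp L = exp 1 * real p / real k" using k by (simp add: L_def)
  have "exp 1 \<le> exp L" unfolding expL using k by (simp add: field_simps)
  then have L1: "1 \<le> L" by simp
  \<comment> \<open>Rounding \<open>p / k\<close> down to \<open>m\<close> loses at most a factor 2,
    since \<open>m\<close> is at least 1; hence the 2 in \<open>L2\<close>.\<close>
  have "p < (m + 1) * k"
    using m dividend_less_div_times[of k p] by (simp add: m_def algebra_simps)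
  also have "\<dots> \<le> 2 * m * k" using m by simp
  finally have "real p \<le> 2 * real m * real k" by (metis less_imp_le of_nat_le_iff of_nat_mult of_nat_numeral)
  then have L2: "exp L \<le> 2 * exp 1 * real m" unfolding expL using m by (simp add: field_simps)
  have pair: "(\<integral>\<^sup>+x. ennreal (?T f x * ?T h x) \<partial>?N) \<le> ennreal (exp (a * L / real k * (pattern_overlap k f h)\<^sup>2))"
    if fh: "f \<in> F" "h \<in> F" for f h
  proof -
    have s: "(\<Sum>j<p. ?v f j * ?v h j) = pattern_overlap k f h / real k"
      using fh m unfolding F_def m_def by (intro block_vec_inner) auto
    have "c\<^sup>2 * M * (pattern_overlap k f h / real k)\<^sup>2 / 2
        \<le> (2 * a * real k * L) * (pattern_overlap k f h / real k)\<^sup>2 / 2"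
      using bound unfolding L_def by (intro divide_right_mono mult_right_mono) auto
    also have "\<dots> = a * L / real k * (pattern_overlap k f h)\<^sup>2"
      using m by (simp add: power2_eq_square)
    finally have "exp (c\<^sup>2 * M * (\<Sum>j<p. ?v f j * ?v h j)\<^sup>2 / 2) \<le> exp (a * L / real k * (pattern_overlap k f h)\<^sup>2)"
      unfolding s by simp
    then show ?thesis
      using nn_integral_truncated_lr_mult_le[OF v[OF fh(1)] v[OF fh(2)] c, of n M]
      by (meson ennreal_leI order_trans)
  qed
  have "(\<integral>\<^sup>+x. ennreal (((\<Sum>f\<in>F. ?T f x) / card F)\<^sup>2) \<partial>?N)
      = (\<integral>\<^sup>+x. ennreal (1 / (card F)\<^sup>2) * (\<Sum>f\<in>F. \<Sum>h\<in>F. ennreal (?T f x * ?T h x)) \<partial>?N)"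
    by (intro nn_integral_cong)
      (simp add: truncated_lr_nonneg sum_nonneg power_divide power2_eq_square sum_product flip: ennreal_mult)
  also have "\<dots> = ennreal (1 / (card F)\<^sup>2) * (\<Sum>f\<in>F. \<Sum>h\<in>F. \<integral>\<^sup>+x. ennreal (?T f x * ?T h x) \<partial>?N)"
    by (simp add: nn_integral_cmult nn_integral_sum del: sum_ennreal)
  also have "\<dots> \<le> ennreal (1 / (card F)\<^sup>2)
      * (\<Sum>f\<in>F. \<Sum>h\<in>F. ennreal (exp (a * L / real k * (pattern_overlap k f h)\<^sup>2)))"
    by (intro mult_left_mono sum_mono pair) auto
  also have "\<dots> \<le> ennreal (1 / (card F)\<^sup>2 * (\<Sum>f\<in>F. card F / sqrt (1 - 36 * a)))"
  proof -
    have "(\<Sum>f\<in>F. \<Sum>h\<in>F. exp (a * L / real k * (pattern_overlap k f h)\<^sup>2)) \<le> (\<Sum>f\<in>F. card F / sqrt (1 - 36 * a))"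
      unfolding cardF using m L1 L2 a
      by (intro sum_mono, unfold F_def m_def[symmetric]) (intro sum_exp_overlap_square_le, auto)
    then have "ennreal (1 / (card F)\<^sup>2 * (\<Sum>f\<in>F. \<Sum>h\<in>F. exp (a * L / real k * (pattern_overlap k f h)\<^sup>2)))
        \<le> ennreal (1 / (card F)\<^sup>2 * (\<Sum>f\<in>F. card F / sqrt (1 - 36 * a)))"
      by (intro ennreal_leI mult_left_mono) auto
    moreover have "ennreal (1 / (card F)\<^sup>2 * (\<Sum>f\<in>F. \<Sum>h\<in>F. exp (a * L / real k * (pattern_overlap k f h)\<^sup>2)))
        = ennreal (1 / (card F)\<^sup>2) * (\<Sum>f\<in>F. \<Sum>h\<in>F. ennreal (exp (a * L / real k * (pattern_overlap k f h)\<^sup>2)))"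
      by (subst ennreal_mult) (simp_all add: sum_nonneg)
    ultimately show ?thesis by simp
  qed
  also have "1 / (card F)\<^sup>2 * (\<Sum>f\<in>F. card F / sqrt (1 - 36 * a)) = 1 / sqrt (1 - 36 * a)"
    using card by (simp add: power2_eq_square)
  finally show ?thesis by (simp add: m_def)
qed

text \<open>Every prior vector keeps the same mass, so averaging over \<open>F\<close> does not
  change it.\<close>

lemma truncated_mixture_mean:
  assumes F: "finite F" "F \<noteq> {}" and v: "\<And>f. f \<in> F \<Longrightarrow> (\<Sum>j<p. v f j * v f j) = 1" and c: "c \<ge> 0"
    and M: "0 < M"
  shows "ennreal (1 - real n / M) \<le> (\<integral>\<^sup>+x. ennreal ((\<Sum>f\<in>F. truncated_lr n p c M (v f) x) / card F) \<partial>std_normal_mat n p)"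
proof -
  let ?i = "\<integral>\<^sup>+g. indicator {g. (\<Sum>i<n. (g i)\<^sup>2) \<le> M} g \<partial>std_normal_vec n"
  have card: "0 < card F" using F by (simp add: card_gt_0_iff)
  have "(\<integral>\<^sup>+x. ennreal ((\<Sum>f\<in>F. truncated_lr n p c M (v f) x) / card F) \<partial>std_normal_mat n p)
     = (\<integral>\<^sup>+x. ennreal (1 / card F) * (\<Sum>f\<in>F. ennreal (truncated_lr n p c M (v f) x)) \<partial>std_normal_mat n p)"
    by (intro nn_integral_cong) (simp add: truncated_lr_nonneg sum_nonneg flip: ennreal_mult)
  also have "\<dots> = ennreal (1 / card F) * (\<Sum>f\<in>F. \<integral>\<^sup>+x. ennreal (truncated_lr n p c M (v f) x) \<partial>std_normal_mat n p)"
    by (simp add: nn_integral_cmult nn_integral_sum del: sum_ennreal)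
  also have "\<dots> = ennreal (1 / card F) * (\<Sum>f\<in>F. ?i)"
    using v by (intro arg_cong2[where f = times] sum.cong refl nn_integral_truncated_lr c) auto
  also have "\<dots> = ennreal (1 / card F) * ennreal (card F) * ?i"
    by (simp add: mult.assoc ennreal_of_nat_eq_real_of_nat)
  also have "\<dots> = ?i" using card by (simp add: flip: ennreal_mult)
  finally show ?thesis using truncation_mass_ge[OF M, of n] by simp
qed

theorem proposition2:
  shows "\<exists>w :: real \<Rightarrow> real.
    (\<forall>b \<in> {0<..<1/36}. w b \<in> {0<..<1}) \<and>
    (w \<longlongrightarrow> 1) (at_right 0) \<and>
    (\<forall>\<beta>\<^sub>0 \<in> {0<..<1/36}. \<forall>n k p :: nat. \<forall>lam :: real.
       1 \<le> k \<longrightarrow> k \<le> p \<longrightarrow> 1 \<le> n \<longrightarrow> 0 < lam \<longrightarrow>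
       lam \<le> min 1 (sqrt (\<beta>\<^sub>0 * real k / real n * ln (exp 1 * real p / real k))) \<longrightarrow>
       w \<beta>\<^sub>0 \<le> minimax_testing_error n p k lam)"
proof -
  \<comment> \<open>\<open>q b / 2 = 3 * sqrt b\<close> bounds the mass lost by truncation, and
    \<open>q b = 36 * a\<close> for \<open>a = sqrt b / 6\<close>; for positive \<open>b\<close>,
    \<open>q b < 1\<close> means \<open>b < 1 / 36\<close>.\<close>
  define q where "q b = 6 * sqrt b" for b :: real
  \<comment> \<open>\<open>w1\<close> and \<open>w2\<close> are the bounds of
    \<open>expectation_min_one_ge\<close> at \<open>\<mu> = 1 - q b / 2\<close> and
    \<open>C = 1 / sqrt (1 - q b)\<close>. The first keeps the maximum positive for all
    \<open>b\<close>, the second gives the limit.\<close>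
  define w1 where "w1 b = 3 / 4 * (1 - q b / 2)\<^sup>2 / (1 / sqrt (1 - q b))" for b
  define w2 where "w2 b = 1 - sqrt (1 - 2 * (1 - q b / 2) + 1 / sqrt (1 - q b))" for b
  define w where "w b = max (w1 b) (w2 b)" for b
  have q: "0 < q b" "q b < 1" if "b \<in> {0<..<1/36}" for b
  proof -
    show "0 < q b" using that by (simp add: q_def)
    have "sqrt b < sqrt ((1 / 6)\<^sup>2)" using that by (intro real_sqrt_less_mono) (simp add: power2_eq_square)
    then show "q b < 1" by (simp add: q_def)
  qed
  have C: "1 \<le> 1 / sqrt (1 - q b)" if "b \<in> {0<..<1/36}" for b
    using q[OF that] by (simp add: field_simps)
  have pos: "0 < 1 - 2 * (1 - q b / 2) + 1 / sqrt (1 - q b)" if "b \<in> {0<..<1/36}" for b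
  proof -
    have "0 < 1 - 2 * (1 - x / 2) + y" if "0 < x" "1 \<le> y" for x y :: real using that by simp
    then show ?thesis using q(1) C that by blast
  qed
  have w_range: "w b \<in> {0<..<1}" if b: "b \<in> {0<..<1/36}" for b
  proof -
    have "0 < w1 b" using q[OF b] by (simp add: w1_def)
    moreover have "w1 b < 1"
    proof -
      have "(1 - q b / 2)\<^sup>2 \<le> 1" using q[OF b] by (intro power_le_one) auto
      moreover have "sqrt (1 - q b) \<le> 1" using q[OF b] by simp
      ultimately have "(1 - q b / 2)\<^sup>2 * sqrt (1 - q b) \<le> 1 * 1" using q[OF b] by (intro mult_mono) auto
      then show ?thesis by (simp add: w1_def)
    qed
    moreover have "0 < sqrt (1 - 2 * (1 - q b / 2) + 1 / sqrt (1 - q b))"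
      using pos[OF b] by (rule real_sqrt_gt_zero)
    then have "w2 b < 1" unfolding w2_def by linarith
    ultimately show ?thesis by (auto simp: w_def)
  qed
  have w_lim: "(w \<longlongrightarrow> 1) (at_right 0)"
  proof (rule tendsto_sandwich)
    have "(sqrt \<longlongrightarrow> sqrt 0) (at_right 0)" by (intro tendsto_intros)
    then have q0: "(q \<longlongrightarrow> 0) (at_right 0)" unfolding q_def[abs_def] by (auto intro!: tendsto_eq_intros)
    \<comment> \<open>As \<open>q b\<close> tends to 0, both \<open>\<mu>\<close> and
      \<open>C\<close> tend to 1 and the root vanishes.\<close>
    show "(w2 \<longlongrightarrow> 1) (at_right 0)"
      unfolding w2_def[abs_def] by (auto intro!: tendsto_eq_intros q0)
    show "((\<lambda>_. 1) \<longlongrightarrow> 1) (at_right (0 :: real))" by simp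
    show "\<forall>\<^sub>F b in at_right 0. w2 b \<le> w b" by (simp add: w_def)
    have "\<forall>\<^sub>F b :: real in at_right 0. b \<in> {0<..<1/36}"
      by (rule eventually_at_right_real) simp
    then show "\<forall>\<^sub>F b in at_right 0. w b \<le> 1"
      by eventually_elim (use w_range in force)
  qed
  have "w b \<le> minimax_testing_error n p k lam"
    if b: "b \<in> {0<..<1/36}" and k: "1 \<le> k" "k \<le> p" and n: "1 \<le> n" and lam: "0 < lam"
      and le: "lam \<le> min 1 (sqrt (b * real k / real n * ln (exp 1 * real p / real k)))"
    for b lam :: real and n k p :: nat
  proof -
    define L where "L = ln (exp 1 * real p / real k)"
    \<comment> \<open>With this \<open>M\<close> the lost mass is at most \<open>3 * sqrt b\<close>
      and \<open>lam\<^sup>2 * M \<le> sqrt b * k * L / 3\<close>, so truncation and second moment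
      are both controlled by \<open>sqrt b\<close>.\<close>
    define M where "M = real n / (3 * sqrt b)"
    have b0: "0 < b" using b by simp
    have M: "0 < M" "real n / M = q b / 2" using n b0 by (auto simp: M_def q_def)
    have a: "0 \<le> sqrt b / 6" "36 * (sqrt b / 6) < 1" "36 * (sqrt b / 6) = q b"
      using q[OF b] by (auto simp: q_def)
    have "lam \<le> sqrt (b * real k / real n * L)" using le by (simp add: L_def)
    then have "lam\<^sup>2 \<le> b * real k / real n * L"
      using lam by (intro sqrt_ge_absD) simp
    then have "lam\<^sup>2 * M \<le> b * real k / real n * L * M" using M by (intro mult_right_mono) auto
    also have "\<dots> = 2 * (sqrt b / 6) * real k * L"
      using n b0 by (simp add: M_def field_simps)
    finally have bound: "lam\<^sup>2 * M \<le> 2 * (sqrt b / 6) * real k * ln (exp 1 * real p / real k)"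
      by (simp add: L_def)
    define F where "F = block_patterns k (p div k)"
    define Z where "Z x = (\<Sum>f\<in>F. truncated_lr n p lam M (block_vec k (p div k) f) x) / card F" for x
    have m: "0 < p div k" "k * (p div k) \<le> p" "0 < k" using k by (auto simp: div_greater_zero_iff)
    have "0 < card F" using m by (simp add: F_def card_block_patterns)
    then have F: "finite F" "F \<noteq> {}" by (auto simp: F_def)
    have norm: "(\<Sum>j<p. block_vec k (p div k) f j * block_vec k (p div k) f j) = 1" if "f \<in> F" for f
      using that m unfolding F_def by (intro block_vec_norm) auto
    have meas: "Z \<in> borel_measurable (std_normal_mat n p)" unfolding Z_def by measurable
    have nonneg: "0 \<le> Z x" for x by (simp add: Z_def sum_nonneg truncated_lr_nonneg)
    have mean: "ennreal (1 - q b / 2) \<le> (\<integral>\<^sup>+x. ennreal (Z x) \<partial>std_normal_mat n p)"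
      using truncated_mixture_mean[where n = n and v = "block_vec k (p div k)", OF F norm less_imp_le[OF lam] M(1)] M(2) by (simp add: Z_def)
    have second: "(\<integral>\<^sup>+x. ennreal ((Z x)\<^sup>2) \<partial>std_normal_mat n p) \<le> ennreal (1 / sqrt (1 - q b))"
      using truncated_mixture_second_moment[OF k less_imp_le[OF lam] less_imp_le[OF M(1)] a(1,2) bound, of n]
      unfolding a(3) by (simp add: Z_def F_def)
    have \<mu>: "0 \<le> 1 - q b / 2" "1 - q b / 2 \<le> 1"
      using q[OF b] by linarith+
    have "w b \<le> (\<integral>x. min 1 (Z x) \<partial>std_normal_mat n p)"
      using std_normal_mat.expectation_min_one_ge[OF meas nonneg mean second \<mu> C[OF b]] pos[OF b]
      by (simp add: w_def w1_def w2_def)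
    also have "\<dots> \<le> minimax_testing_error n p k lam"
      using minimax_testing_error_ge[OF k less_imp_le[OF lam]] by (simp add: Z_def F_def)
    finally show ?thesis .
  qed
  then show ?thesis using w_range w_lim by blast
qed

end
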